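(* Let $n \geq 1$, let $x_1,\dots,x_n$, $y_1,\dots,y_n$ and $t$ be indeterminates, and write $\bar{y}_i = 1/y_i$. Then $$ \sum_{\lambda}\prod_{i=1}^{n}\left(1-t^{\lambda_i-i+n+1}\right) s_{\lambda}(x_1,\dots,x_n)\, sp_{\lambda}(y_1,\bar{y}_1,\dots,y_n,\bar{y}_n) $$ $$ = \frac{\prod_{i=1}^{n}(1-t x_i^2)}{\prod_{1\leq i<j\leq n}(x_i-x_j)\ \prod_{1\leq i<j\leq n}(y_i-y_j)\ \prod_{1\leq i<j\leq n}(1-\bar{y}_i\bar{y}_j)} \det\left[\frac{(1-t)}{(1-x_i y_j)(1-t x_i y_j)(1-x_i\bar{y}_j)(1-t x_i\bar{y}_j)}\right]_{1\leq i,j\leq n}, $$ where the sum is over all partitions $\lambda=(\lambda_1\geq\cdots\geq\lambda_n\geq 0)$ with at most $n$ non-zero parts.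
   Context: A partition is a finite weakly decreasing sequence of positive integers (possibly empty); a partition with at most $n$ parts is padded with zeros so that $\lambda_1,\dots,\lambda_n$ are all defined. For a partition $\lambda$ with at most $n$ parts, the Schur polynomial is $$ s_{\lambda}(x_1,\dots,x_n)=\frac{\det\left[x_i^{\lambda_j-j+n}\right]_{1\leq i,j\leq n}}{\prod_{1\leq i<j\leq n}(x_i-x_j)}, $$ and the symplectic character (the irreducible character of $Sp(2n)$ indexed by $\lambda$) is the Laurent polynomial $$ sp_{\lambda}(y_1,\bar{y}_1,\dots,y_n,\bar{y}_n)=\frac{\det\left[y_i^{\lambda_j-j+n+1}-\bar{y}_i^{\,\lambda_j-j+n+1}\right]_{1\leq i,j\leq n}}{\prod_{i=1}^{n}(y_i-\bar{y}_i)\prod_{1\leq i<j\leq n}(y_i-y_j)(1-\bar{y}_i\bar{y}_j)} . $$ The identity is understood as one of formal power series in $x_1,\dots,x_n$ whose coefficients are polynomial in $t$ and Laurent polynomial in $y_1,\dots,y_n$, the entries of the determinant being expanded as power series in the $x_i$. *)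

theory Defs
  imports
    "HOL-Library.Multiset_Order"
    "HOL-Library.Poly_Mapping"
    "HOL-Computational_Algebra.Computational_Algebra"
    "Jordan_Normal_Form.Determinant"
begin

section \<open>Formal power series in countably many commuting variables\<close>

text \<open>
  A monomial is represented by the multiset of its variables: \<open>M\<close> stands for
  the product of the variables with index \<open>i\<close>, \<open>i\<close> running through \<open>M\<close> with
  multiplicity. All formal sums of monomials with coefficients in \<open>'a\<close> are allowed.
\<close>

typedef 'a mps = "UNIV :: (nat multiset \<Rightarrow> 'a) set"
  morphisms mps_coeff Abs_mps ..

lemma mps_coeff_Abs [simp]: "mps_coeff (Abs_mps f) = f"
  by (simp add: Abs_mps_inverse)

lemma mps_eqI: "(\<And>M. mps_coeff f M = mps_coeff g M) \<Longrightarrow> f = g"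
  by (metis ext mps_coeff_inject)

lemma mps_eq_iff: "f = g \<longleftrightarrow> (\<forall>M. mps_coeff f M = mps_coeff g M)"
  by (auto intro: mps_eqI)

definition msplits :: "nat multiset \<Rightarrow> (nat multiset \<times> nat multiset) set" where
  "msplits M = {(A, B). A + B = M}"

lemma msplits_iff [simp]: "(A, B) \<in> msplits M \<longleftrightarrow> A + B = M"
  by (simp add: msplits_def)

lemma finite_msplits [simp, intro]: "finite (msplits M)"
proof (induction M)
  case empty
  have "msplits {#} = {({#}, {#})}"
    by (auto simp: msplits_def)
  then show ?case by simp
next
  case (add x M)
  have "msplits (add_mset x M) \<subseteq>
      (\<lambda>(A, B). (add_mset x A, B)) ` msplits M \<union> (\<lambda>(A, B). (A, add_mset x B)) ` msplits M"
  proof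
    fix p assume p: "p \<in> msplits (add_mset x M)"
    obtain A B where AB: "p = (A, B)" "A + B = add_mset x M"
      using p by (cases p) auto
    have "x \<in># A + B" using AB by simp
    then consider A' where "A = add_mset x A'" | B' where "B = add_mset x B'"
      by (metis insert_DiffM union_iff)
    then show "p \<in> (\<lambda>(A, B). (add_mset x A, B)) ` msplits M \<union>
        (\<lambda>(A, B). (A, add_mset x B)) ` msplits M"
    proof cases
      case (1 A')
      then have "(A', B) \<in> msplits M" using AB by simp
      then show ?thesis using 1 AB by force
    next
      case (2 B')
      then have "(A, B') \<in> msplits M" using AB by simp
      then show ?thesis using 2 AB by force
    qed
  qed
  then show ?case
    by (rule finite_subset) (use add in auto)
qed

definition mps_const :: "'a::zero \<Rightarrow> 'a mps" where
  "mps_const c = Abs_mps (\<lambda>M. if M = {#} then c else 0)"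

definition mps_var :: "nat \<Rightarrow> 'a::zero_neq_one mps" where
  "mps_var i = Abs_mps (\<lambda>M. if M = {#i#} then 1 else 0)"

instantiation mps :: (comm_ring_1) comm_ring_1
begin

definition "0 = Abs_mps (\<lambda>M. 0)"
definition "1 = Abs_mps (\<lambda>M. if M = {#} then 1 else 0)"
definition "f + g = Abs_mps (\<lambda>M. mps_coeff f M + mps_coeff g M)"
definition "f - g = Abs_mps (\<lambda>M. mps_coeff f M - mps_coeff g M)"
definition "- f = Abs_mps (\<lambda>M. - mps_coeff f M)"
definition "f * g = Abs_mps (\<lambda>M. \<Sum>(A, B)\<in>msplits M. mps_coeff f A * mps_coeff g B)"

instance
proof
  fix a b c :: "'a mps"
  note defs = zero_mps_def one_mps_def plus_mps_def minus_mps_def uminus_mps_def times_mps_def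
  show "a + b + c = a + (b + c)" "a + b = b + a" "0 + a = a" "- a + a = 0" "a - b = a + - b"
    by (simp_all add: defs mps_eq_iff algebra_simps)
  show "(0 :: 'a mps) \<noteq> 1"
    by (auto simp: defs mps_eq_iff)
  show "(a + b) * c = a * c + b * c"
    by (simp add: defs mps_eq_iff algebra_simps sum.distrib case_prod_unfold)
  show "a * b = b * a"
  proof (rule mps_eqI)
    fix M
    show "mps_coeff (a * b) M = mps_coeff (b * a) M"
      unfolding times_mps_def mps_coeff_Abs
      by (rule sum.reindex_bij_witness[of _ prod.swap prod.swap])
        (auto simp: algebra_simps)
  qed
  show "1 * a = a"
  proof (rule mps_eqI)
    fix M
    have "mps_coeff (1 * a) M = (\<Sum>(A, B)\<in>{({#}, M)}. mps_coeff 1 A * mps_coeff a B)"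
      unfolding times_mps_def mps_coeff_Abs
      by (rule sum.mono_neutral_right) (auto simp: one_mps_def split: if_splits)
    then show "mps_coeff (1 * a) M = mps_coeff a M"
      by (simp add: one_mps_def)
  qed
  show "a * b * c = a * (b * c)"
  proof (rule mps_eqI)
    fix M
    have "mps_coeff (a * b * c) M =
        (\<Sum>p\<in>msplits M. \<Sum>q\<in>msplits (fst p).
           mps_coeff a (fst q) * mps_coeff b (snd q) * mps_coeff c (snd p))"
      by (simp add: times_mps_def case_prod_unfold sum_distrib_right)
    also have "\<dots> = (\<Sum>(p, q)\<in>Sigma (msplits M) (\<lambda>p. msplits (fst p)).
           mps_coeff a (fst q) * mps_coeff b (snd q) * mps_coeff c (snd p))"
      by (subst sum.Sigma) auto
    also have "\<dots> = (\<Sum>(p, q)\<in>Sigma (msplits M) (\<lambda>p. msplits (snd p)).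
           mps_coeff a (fst p) * (mps_coeff b (fst q) * mps_coeff c (snd q)))"
      by (rule sum.reindex_bij_witness[of _
            "\<lambda>(p, q). ((fst p + fst q, snd q), (fst p, fst q))"
            "\<lambda>(p, q). ((fst q, snd q + snd p), (snd q, snd p))"])
        (auto simp: algebra_simps)
    also have "\<dots> = (\<Sum>p\<in>msplits M. \<Sum>q\<in>msplits (snd p).
           mps_coeff a (fst p) * (mps_coeff b (fst q) * mps_coeff c (snd q)))"
      by (subst sum.Sigma) auto
    also have "\<dots> = mps_coeff (a * (b * c)) M"
      by (simp add: times_mps_def case_prod_unfold sum_distrib_left)
    finally show "mps_coeff (a * b * c) M = mps_coeff (a * (b * c)) M" .
  qed
qed

end

instance mps :: (idom) idom
proof
  fix a b :: "'a mps"
  assume "a \<noteq> 0" "b \<noteq> 0"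
  define M where "M = (LEAST M. mps_coeff a M \<noteq> 0)"
  define N where "N = (LEAST N. mps_coeff b N \<noteq> 0)"
  have M: "mps_coeff a M \<noteq> 0" and N: "mps_coeff b N \<noteq> 0"
    unfolding M_def N_def using \<open>a \<noteq> 0\<close> \<open>b \<noteq> 0\<close>
    by (metis (mono_tags, lifting) LeastI mps_coeff_Abs mps_eq_iff zero_mps_def)+
  have M_le: "mps_coeff a A = 0" if "A < M" for A
    using that not_less_Least unfolding M_def by blast
  have N_le: "mps_coeff b B = 0" if "B < N" for B
    using that not_less_Least unfolding N_def by blast
  have "mps_coeff a A * mps_coeff b B = 0" if "A + B = M + N" "(A, B) \<noteq> (M, N)" for A B
  proof (cases A M rule: linorder_cases)
    case less
    then show ?thesis by (simp add: M_le)
  next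
    case equal
    then show ?thesis using that by simp
  next
    case greater
    then have "B < N"
      using that by (metis add_less_le_mono linorder_not_le order_less_irrefl)
    then show ?thesis by (simp add: N_le)
  qed
  then have "\<forall>p\<in>msplits (M + N) - {(M, N)}. (case p of (A, B) \<Rightarrow> mps_coeff a A * mps_coeff b B) = 0"
    by (metis (no_types, lifting) DiffE case_prod_conv insertCI msplits_iff surj_pair)
  then have "mps_coeff (a * b) (M + N) = (\<Sum>(A, B)\<in>{(M, N)}. mps_coeff a A * mps_coeff b B)"
    unfolding times_mps_def mps_coeff_Abs
    by (rule sum.mono_neutral_right[OF finite_msplits, rotated]) simp
  then have "mps_coeff (a * b) (M + N) \<noteq> 0"
    using M N by simp
  then show "a * b \<noteq> 0"
    by (auto simp: zero_mps_def)
qed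

text \<open>
  An infinite sum of elements of the fraction field of the power series ring: all summands
  have to be power series, and every monomial may have a non-zero coefficient in only
  finitely many of them.
\<close>

definition has_formal_sum :: "('b \<Rightarrow> 'a::idom mps fract) \<Rightarrow> 'b set \<Rightarrow> 'a mps fract \<Rightarrow> bool" where
  "has_formal_sum f I s \<longleftrightarrow>
     (\<exists>g S. (\<forall>i\<in>I. f i = to_fract (g i)) \<and> s = to_fract S \<and>
        (\<forall>M. finite {i\<in>I. mps_coeff (g i) M \<noteq> 0} \<and>
             mps_coeff S M = (\<Sum>i\<in>{i\<in>I. mps_coeff (g i) M \<noteq> 0}. mps_coeff (g i) M)))"


section \<open>The indeterminates\<close>

text \<open>
  Laurent polynomials over \<open>\<int>[t]\<close>: finitely supported functions on exponent vectors with
  integer entries.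
\<close>

type_synonym laurent = "(nat \<Rightarrow>\<^sub>0 int) \<Rightarrow>\<^sub>0 int poly"

text \<open>
  The identity lives in the fraction field of the ring of power series in the
  \<open>x\<^sub>i\<close> over the Laurent polynomials in the \<open>y\<^sub>i\<close> over \<open>\<int>[t]\<close>. There,
  \<open>1 / (1 - x\<^sub>i y\<^sub>j)\<close> is the geometric series, and \<open>1 / y\<^sub>i\<close> is the Laurent monomial with
  exponent \<open>-1\<close>.
\<close>

type_synonym ambient = "laurent mps fract"

definition xvar :: "nat \<Rightarrow> ambient" where
  "xvar i = to_fract (mps_var i)"

definition yvar :: "nat \<Rightarrow> ambient" where
  "yvar i = to_fract (mps_const (Poly_Mapping.single (Poly_Mapping.single i 1) 1))"

definition tvar :: ambient where
  "tvar = to_fract (mps_const (Poly_Mapping.single 0 [:0, 1:]))"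


section \<open>Partitions, Schur polynomials and symplectic characters\<close>

definition is_partition :: "nat list \<Rightarrow> bool" where
  "is_partition lam \<longleftrightarrow> sorted_wrt (\<ge>) lam \<and> (\<forall>p\<in>set lam. p > 0)"

text \<open>Parts are numbered from 1 and padded with zeros.\<close>

definition part :: "nat list \<Rightarrow> nat \<Rightarrow> nat" where
  "part lam i = (if 1 \<le> i \<and> i \<le> length lam then lam ! (i - 1) else 0)"

definition det_from1 :: "nat \<Rightarrow> (nat \<Rightarrow> nat \<Rightarrow> 'a::comm_ring_1) \<Rightarrow> 'a" where
  "det_from1 n a = det (mat n n (\<lambda>(i, j). a (i + 1) (j + 1)))"

text \<open>
  The exponents below are natural numbers, as the column index \<open>j\<close> is at most \<open>n\<close>; hence
  \<open>part lam j + n - j\<close> does not truncate.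
\<close>

definition schur :: "nat \<Rightarrow> nat list \<Rightarrow> (nat \<Rightarrow> 'a::field) \<Rightarrow> 'a" where
  "schur n lam x =
     det_from1 n (\<lambda>i j. x i ^ (part lam j + n - j)) /
     (\<Prod>j=1..n. \<Prod>i=1..<j. x i - x j)"

definition symplectic :: "nat \<Rightarrow> nat list \<Rightarrow> (nat \<Rightarrow> 'a::field) \<Rightarrow> 'a" where
  "symplectic n lam y =
     det_from1 n (\<lambda>i j. y i ^ (part lam j + n + 1 - j) - (1 / y i) ^ (part lam j + n + 1 - j)) /
     ((\<Prod>i=1..n. y i - 1 / y i) *
      (\<Prod>j=1..n. \<Prod>i=1..<j. (y i - y j) * (1 - (1 / y i) * (1 / y j))))"

end

theory Submission
  imports Defs
begin

text \<open>
  Put \<open>z\<^sub>i = y\<^sub>i + 1/y\<^sub>i\<close> and let \<open>U\<^sub>m\<close> be the Chebyshev polynomials of the second kind. As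
  \<open>(y\<^sub>i - y\<^sub>j)(1 - 1/(y\<^sub>i y\<^sub>j)) = z\<^sub>i - z\<^sub>j\<close>, the symplectic character is the quotient of
  \<open>det [U\<^sub>l(z\<^sub>i)]\<close>, with column exponents \<open>l = \<lambda>\<^sub>j + n - j\<close>, by the Vandermonde product of the
  \<open>z\<^sub>i\<close>. The partitions with at most \<open>n\<close> parts correspond to the strictly decreasing sequences
  of \<open>n\<close> exponents, so Cauchy--Binet collects the sum over all partitions into the determinant
  of the series \<open>\<Sum>\<^sub>l x\<^sub>i\<^sup>l (1 - t\<^bsup>l+1\<^esup>) U\<^sub>l(z\<^sub>j)\<close>, whose closed form is \<open>(1 - t x\<^sub>i\<^sup>2)\<close> times
  the matrix entry of the theorem. The infinite version of Cauchy--Binet follows from the finite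
  one by comparing power series up to any given total degree in the \<open>x\<^sub>i\<close>.
\<close>

section \<open>Determinants\<close>

text \<open>Entries given as functions of indices starting at 0 keep matrices and their dimension
  conditions out of the later calculations.\<close>

definition fdet :: "nat \<Rightarrow> (nat \<Rightarrow> nat \<Rightarrow> 'a) \<Rightarrow> 'a::comm_ring_1" where
  "fdet n a = det (mat n n (\<lambda>(i, j). a i j))"

lemma det_from1_eq_fdet: "det_from1 n a = fdet n (\<lambda>i j. a (Suc i) (Suc j))"
  by (simp add: det_from1_def fdet_def)

lemma fdet_cong:
  assumes "\<And>i j. i < n \<Longrightarrow> j < n \<Longrightarrow> a i j = b i j"
  shows "fdet n a = fdet n b"
  unfolding fdet_def by (rule arg_cong[of _ _ det]) (auto simp: assms)

lemma fdet_leibniz: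
  "fdet n a = (\<Sum>p | p permutes {..<n}. signof p * (\<Prod>i<n. a i (p i)))"
proof -
  have "mat n n (\<lambda>(i, j). a i j) $$ (i, p i) = a i (p i)" if "p permutes {..<n}" "i < n" for p i
    using permutes_in_image[OF that(1), of i] that(2) by simp
  then show ?thesis
    by (auto simp: fdet_def det_def atLeast0LessThan intro!: sum.cong prod.cong arg_cong2[of _ _ _ _ "(*)"])
qed

lemma fdet_transpose: "fdet n (\<lambda>i j. a j i) = fdet n a"
proof -
  have "transpose_mat (mat n n (\<lambda>(i, j). a i j)) = mat n n (\<lambda>(i, j). a j i)"
    by (rule eq_matI) auto
  then show ?thesis
    using det_transpose[of "mat n n (\<lambda>(i, j). a i j)" n] by (simp add: fdet_def)
qed

lemma fdet_scale_rows: "fdet n (\<lambda>i j. c i * a i j) = (\<Prod>i<n. c i) * fdet n a"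
  by (simp add: fdet_leibniz prod.distrib sum_distrib_left algebra_simps)

lemma fdet_permute_rows:
  assumes "p permutes {..<n}"
  shows "fdet n (\<lambda>i j. a (p i) j) = signof p * fdet n a"
proof -
  have "mat n n (\<lambda>(i, j). mat n n (\<lambda>(i, j). a i j) $$ (p i, j)) = mat n n (\<lambda>(i, j). a (p i) j)"
    using permutes_in_image[OF assms] by (intro eq_matI) auto
  then show ?thesis
    using det_permute_rows[of "mat n n (\<lambda>(i, j). a i j)" n p] assms
    by (simp add: fdet_def atLeast0LessThan)
qed

lemma fdet_identical_rows:
  assumes "i < n" "k < n" "i \<noteq> k" "\<And>j. j < n \<Longrightarrow> a i j = a k j"
  shows "fdet n a = 0"
  unfolding fdet_def
  by (rule det_identical_rows[of _ n i k]) (use assms in \<open>auto intro!: eq_vecI\<close>)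

lemma fdet_mult:
  "fdet n (\<lambda>i j. \<Sum>k<n. a i k * b k j) = fdet n a * fdet n b"
proof -
  have "mat n n (\<lambda>(i, j). \<Sum>k<n. a i k * b k j) =
      mat n n (\<lambda>(i, j). a i j) * mat n n (\<lambda>(i, j). b i j)"
    by (rule eq_matI) (auto simp: scalar_prod_def atLeast0LessThan)
  then show ?thesis
    by (simp add: fdet_def det_mult[of _ n])
qed

lemma fdet_lower_triangular:
  assumes "\<And>i j. i < j \<Longrightarrow> j < n \<Longrightarrow> a i j = 0"
  shows "fdet n a = (\<Prod>i<n. a i i)"
proof -
  have "fdet n a = prod_list (diag_mat (mat n n (\<lambda>(i, j). a i j)))"
    unfolding fdet_def by (rule det_lower_triangular[of n]) (use assms in auto)
  also have "diag_mat (mat n n (\<lambda>(i, j). a i j)) = map (\<lambda>i. a i i) [0..<n]"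
    by (auto simp: diag_mat_def)
  finally show ?thesis
    by (simp add: prod.distinct_set_conv_list[symmetric] atLeast0LessThan)
qed

section \<open>Newton interpolation and divisibility by the Vandermonde product\<close>

lemma newton_interpolation:
  fixes p :: "'a::comm_ring_1 poly" and n :: nat
  shows "\<exists>c. \<forall>i<n. poly p (x i) = (\<Sum>k<n. (\<Prod>m<k. x i - x m) * c k)"
proof (induction n arbitrary: p x)
  case 0
  then show ?case by simp
next
  case (Suc n)
  \<comment> \<open>Division by the monic factor \<open>X - x 0\<close> works over any commutative
    ring, even if nodes coincide. The quotient and the remaining nodes form a smaller instance, so
    both \<open>p\<close> and \<open>x\<close> vary in the induction.\<close>
  define q where "q = synthetic_div p (x 0)"
  have q: "poly p z = poly p (x 0) + (z - x 0) * poly q z" for z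
    using arg_cong[OF synthetic_div_correct'[of "x 0" p], of "\<lambda>r. poly r z"]
    by (simp add: q_def algebra_simps)
  from Suc.IH[of q "\<lambda>i. x (Suc i)"] obtain c
    where c: "\<forall>i<n. poly q (x (Suc i)) = (\<Sum>k<n. (\<Prod>m<k. x (Suc i) - x (Suc m)) * c k)"
    by blast
  \<comment> \<open>The value at the first node becomes the constant coefficient and the
    coefficients of \<open>q\<close> move up one place; at the first node only \<open>k = 0\<close>
    survives.\<close>
  have "poly p (x i) =
      (\<Sum>k<Suc n. (\<Prod>m<k. x i - x m) * (case k of 0 \<Rightarrow> poly p (x 0) | Suc k \<Rightarrow> c k))"
    if "i < Suc n" for i
  proof (cases i)
    case 0
    then show ?thesis
      by (simp add: sum.lessThan_Suc_shift prod.lessThan_Suc_shift del: sum.lessThan_Suc prod.lessThan_Suc)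
  next
    case (Suc j)
    then have "poly q (x (Suc j)) = (\<Sum>k<n. (\<Prod>m<k. x (Suc j) - x (Suc m)) * c k)"
      using c that by simp
    with q[of "x i"] Suc show ?thesis
      by (simp add: sum.lessThan_Suc_shift prod.lessThan_Suc_shift sum_distrib_left mult.assoc
          del: sum.lessThan_Suc prod.lessThan_Suc)
  qed
  then show ?case by blast
qed

text \<open>
  By Newton interpolation the matrix is the product of the lower triangular matrix of the
  Newton basis at the nodes and the matrix of the Newton coefficients.
\<close>

lemma vandermonde_dvd_fdet:
  fixes p :: "nat \<Rightarrow> 'a::comm_ring_1 poly"
  shows "(\<Prod>j<n. \<Prod>i<j. x i - x j) dvd fdet n (\<lambda>i j. poly (p j) (x i))"
proof -
  have "\<forall>j. \<exists>c. \<forall>i<n. poly (p j) (x i) = (\<Sum>k<n. (\<Prod>m<k. x i - x m) * c k)"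
    using newton_interpolation by blast
  then obtain c where c: "\<forall>j. \<forall>i<n. poly (p j) (x i) = (\<Sum>k<n. (\<Prod>m<k. x i - x m) * c j k)"
    by metis
  have "fdet n (\<lambda>i j. poly (p j) (x i)) = fdet n (\<lambda>i j. \<Sum>k<n. (\<Prod>m<k. x i - x m) * c j k)"
    by (rule fdet_cong) (use c in simp)
  also have "\<dots> = fdet n (\<lambda>i k. \<Prod>m<k. x i - x m) * fdet n (\<lambda>k j. c j k)"
    by (rule fdet_mult)
  also have "fdet n (\<lambda>i k. \<Prod>m<k. x i - x m) = (\<Prod>j<n. \<Prod>i<j. x j - x i)"
    by (rule fdet_lower_triangular) (auto intro!: prod_zero)
  finally have "(\<Prod>j<n. \<Prod>i<j. x j - x i) dvd fdet n (\<lambda>i j. poly (p j) (x i))"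
    by simp
  \<comment> \<open>The factors differ by signs only, which divisibility ignores.\<close>
  moreover have "(\<Prod>j<n. \<Prod>i<j. x i - x j) dvd (\<Prod>j<n. \<Prod>i<j. x j - x i)"
    by (intro prod_dvd_prod) (metis dvd_minus_iff dvd_refl minus_diff_eq)
  ultimately show ?thesis
    by (rule dvd_trans[rotated])
qed

section \<open>Strictly decreasing index sequences and the Cauchy--Binet formula\<close>

definition decreasing_seqs :: "nat \<Rightarrow> nat \<Rightarrow> (nat \<Rightarrow> nat) set" where
  "decreasing_seqs n K = {e \<in> {..<n} \<rightarrow>\<^sub>E {..<K}. \<forall>i j. i < j \<longrightarrow> j < n \<longrightarrow> e j < e i}"

lemma decreasing_seqs_inj:
  assumes "e \<in> decreasing_seqs n K"
  shows "inj_on e {..<n}"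
  using assms unfolding decreasing_seqs_def inj_on_def
  by (metis (mono_tags, lifting) lessThan_iff less_irrefl linorder_neqE_nat mem_Collect_eq)

text \<open>Reversing the list of values makes it strictly ascending, and such a list is determined
  by its set of entries.\<close>

lemma decreasing_seqs_image_unique:
  assumes "e \<in> decreasing_seqs n K" "e' \<in> decreasing_seqs n K" "e ` {..<n} = e' ` {..<n}"
  shows "e = e'"
proof -
  have sd: "sorted_wrt (<) (rev (map f [0..<n]))" if "f \<in> decreasing_seqs n K" for f
    using that unfolding decreasing_seqs_def sorted_wrt_rev by (auto simp: sorted_wrt_iff_nth_less)
  have "rev (map e [0..<n]) = rev (map e' [0..<n])"
    by (rule strict_sorted_equal) (use sd assms in \<open>auto simp: atLeast0LessThan\<close>)
  then have "e i = e' i" if "i \<in> {..<n}" for i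
    using that by (simp add: atLeast0LessThan)
  then show ?thesis
    using assms(1,2) unfolding decreasing_seqs_def by (auto intro: PiE_ext)
qed

lemma decreasing_seqs_enumerate:
  assumes "X \<subseteq> {..<K}" "card X = n"
  obtains e where "e \<in> decreasing_seqs n K" "e ` {..<n} = X"
proof -
  have fin: "finite X" using assms(1) finite_subset by blast
  define xs where "xs = rev (sorted_list_of_set X)"
  have len: "length xs = n" and set: "set xs = X"
    using assms fin by (auto simp: xs_def)
  have sd: "sorted_wrt (>) xs"
    by (simp add: xs_def sorted_wrt_rev)
  show ?thesis
  proof
    show "restrict (\<lambda>i. xs ! i) {..<n} \<in> decreasing_seqs n K"
      using assms set len sd
      by (auto simp: decreasing_seqs_def sorted_wrt_iff_nth_less set_conv_nth)
    show "restrict (\<lambda>i. xs ! i) {..<n} ` {..<n} = X"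
      using set len by (auto simp: set_conv_nth)
  qed
qed

text \<open>An injective function splits into its sorted values \<open>e\<close> and the permutation
  \<open>p\<close> saying which of them each index takes. Its image determines \<open>e\<close>, and
  then injectivity of \<open>e\<close> determines \<open>p\<close>.\<close>

lemma bij_betw_decreasing_seqs_permutes:
  "bij_betw (\<lambda>(e, p). \<lambda>i\<in>{..<n}. e (p i)) (decreasing_seqs n K \<times> {p. p permutes {..<n}})
     {f \<in> {..<n} \<rightarrow>\<^sub>E {..<K}. inj_on f {..<n}}"
proof (rule bij_betw_imageI)
  show "inj_on (\<lambda>(e, p). \<lambda>i\<in>{..<n}. e (p i)) (decreasing_seqs n K \<times> {p. p permutes {..<n}})"
  proof (rule inj_onI, clarify)
    fix e p e' p'
    assume e: "e \<in> decreasing_seqs n K" "e' \<in> decreasing_seqs n K"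
      and p: "p permutes {..<n}" "p' permutes {..<n}"
      and eq: "(\<lambda>i\<in>{..<n}. e (p i)) = (\<lambda>i\<in>{..<n}. e' (p' i))"
    have eq': "e (p i) = e' (p' i)" if "i < n" for i
      using fun_cong[OF eq, of i] that by simp
    have "e ` {..<n} = e ` p ` {..<n}" using p by (simp add: permutes_image)
    also have "\<dots> = e' ` p' ` {..<n}" using eq' by (force simp: image_image)
    also have "\<dots> = e' ` {..<n}" using p by (simp add: permutes_image)
    finally have ee: "e = e'" by (rule decreasing_seqs_image_unique[OF e])
    have "p i = p' i" for i
    proof (cases "i < n")
      case True
      then show ?thesis
        using eq'[OF True] decreasing_seqs_inj[OF e(1)] permutes_in_image[OF p(1), of i]
          permutes_in_image[OF p(2), of i]
        by (auto simp: ee inj_on_def)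
    next
      case False
      then show ?thesis using p by (simp add: permutes_not_in)
    qed
    then show "e = e' \<and> p = p'" using ee by auto
  qed
next
  show "(\<lambda>(e, p). \<lambda>i\<in>{..<n}. e (p i)) ` (decreasing_seqs n K \<times> {p. p permutes {..<n}}) =
    {f \<in> {..<n} \<rightarrow>\<^sub>E {..<K}. inj_on f {..<n}}"
  proof (intro equalityI subsetI)
    fix f assume "f \<in> (\<lambda>(e, p). \<lambda>i\<in>{..<n}. e (p i)) ` (decreasing_seqs n K \<times> {p. p permutes {..<n}})"
    then obtain e p where e: "e \<in> decreasing_seqs n K" and p: "p permutes {..<n}"
      and f: "f = (\<lambda>i\<in>{..<n}. e (p i))" by auto
    have "p i < n" if "i < n" for i
      using permutes_in_image[OF p, of i] that by simp
    moreover have "e i < K" if "i < n" for i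
      using e that by (auto simp: decreasing_seqs_def)
    moreover have "inj_on (e \<circ> p) {..<n}"
      using decreasing_seqs_inj[OF e] p
      by (intro comp_inj_on) (auto simp: permutes_image intro: permutes_inj_on)
    ultimately show "f \<in> {f \<in> {..<n} \<rightarrow>\<^sub>E {..<K}. inj_on f {..<n}}"
      unfolding f by (auto simp: inj_on_def)
  next
    fix f assume "f \<in> {f \<in> {..<n} \<rightarrow>\<^sub>E {..<K}. inj_on f {..<n}}"
    then have f: "f \<in> {..<n} \<rightarrow>\<^sub>E {..<K}" "inj_on f {..<n}" by auto
    then obtain e where e: "e \<in> decreasing_seqs n K" "e ` {..<n} = f ` {..<n}"
      using decreasing_seqs_enumerate[of "f ` {..<n}" K n] by (force simp: card_image)
    \<comment> \<open>The position of \<open>f i\<close> among the sorted values, extended by the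
      identity so that \<open>p\<close> is a permutation of all naturals.\<close>
    define p where "p = (\<lambda>i. if i \<in> {..<n} then inv_into {..<n} e (f i) else i)"
    have "bij_betw (inv_into {..<n} e \<circ> f) {..<n} {..<n}"
      using f(2) e decreasing_seqs_inj[OF e(1)]
      by (metis bij_betw_imageI bij_betw_inv_into bij_betw_trans)
    then have "bij_betw p {..<n} {..<n}"
      by (subst bij_betw_cong[of _ _ "inv_into {..<n} e \<circ> f"]) (auto simp: p_def)
    then have "p permutes {..<n}"
      by (rule bij_imp_permutes) (auto simp: p_def)
    moreover have "f = (\<lambda>i\<in>{..<n}. e (p i))"
    proof
      fix i
      show "f i = (\<lambda>i\<in>{..<n}. e (p i)) i"
      proof (cases "i < n")
        case True
        then have "f i \<in> e ` {..<n}" using e(2) by auto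
        then show ?thesis using True by (simp add: p_def f_inv_into_f)
      next
        case False
        then show ?thesis using f(1) by (auto simp: PiE_def extensional_def)
      qed
    qed
    ultimately show "f \<in> (\<lambda>(e, p). \<lambda>i\<in>{..<n}. e (p i)) ` (decreasing_seqs n K \<times> {p. p permutes {..<n}})"
      using e(1) by force
  qed
qed

text \<open>Expanding the determinant yields one term for each choice \<open>f\<close> of a summand
  in every row. A non-injective \<open>f\<close> repeats a row of \<open>b\<close> and gives 0. The
  injective ones are grouped by their sorted values \<open>e\<close>; reordering the rows of
  \<open>b\<close> contributes the sign that completes the Leibniz formula for the minor of
  \<open>a\<close>.\<close>

lemma cauchy_binet:
  "fdet n (\<lambda>i j. \<Sum>l<K. a i l * b l j) =
   (\<Sum>e\<in>decreasing_seqs n K. fdet n (\<lambda>i j. a i (e j)) * fdet n (\<lambda>i j. b (e i) j))"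
proof -
  let ?F = "{..<n} \<rightarrow>\<^sub>E {..<K}" and ?P = "{p. p permutes {..<n}}"
  let ?h = "\<lambda>f. (\<Prod>i<n. a i (f i)) * fdet n (\<lambda>i j. b (f i) j)"
  have fin: "finite ?F" by (intro finite_PiE) auto
  have "fdet n (\<lambda>i j. \<Sum>l<K. a i l * b l j) =
      (\<Sum>p\<in>?P. \<Sum>f\<in>?F. signof p * (\<Prod>i<n. a i (f i) * b (f i) (p i)))"
    by (simp add: fdet_leibniz prod_sum_PiE sum_distrib_left)
  also have "\<dots> = (\<Sum>f\<in>?F. ?h f)"
    by (subst sum.swap) (simp add: fdet_leibniz sum_distrib_left prod.distrib algebra_simps)
  also have "\<dots> = (\<Sum>f\<in>{f \<in> ?F. inj_on f {..<n}}. ?h f)"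
  proof (rule sum.mono_neutral_right)
    show "\<forall>f\<in>?F - {f \<in> ?F. inj_on f {..<n}}. ?h f = 0"
    proof
      fix f assume "f \<in> ?F - {f \<in> ?F. inj_on f {..<n}}"
      then obtain i k where "i < n" "k < n" "i \<noteq> k" "f i = f k"
        by (auto simp: inj_on_def)
      then have "fdet n (\<lambda>i j. b (f i) j) = 0"
        by (intro fdet_identical_rows[of i n k]) auto
      then show "?h f = 0" by simp
    qed
  qed (use fin in auto)
  also have "\<dots> = (\<Sum>(e, p)\<in>decreasing_seqs n K \<times> ?P. ?h (\<lambda>i\<in>{..<n}. e (p i)))"
    by (subst sum.reindex_bij_betw[OF bij_betw_decreasing_seqs_permutes, symmetric])
      (simp add: case_prod_unfold)
  also have "\<dots> = (\<Sum>e\<in>decreasing_seqs n K. \<Sum>p\<in>?P. ?h (\<lambda>i\<in>{..<n}. e (p i)))"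
    by (simp add: sum.cartesian_product)
  also have "\<dots> = (\<Sum>e\<in>decreasing_seqs n K.
      fdet n (\<lambda>i j. a i (e j)) * fdet n (\<lambda>i j. b (e i) j))"
  proof (rule sum.cong[OF refl])
    fix e assume "e \<in> decreasing_seqs n K"
    have "(\<Sum>p\<in>?P. ?h (\<lambda>i\<in>{..<n}. e (p i))) =
        (\<Sum>p\<in>?P. (\<Prod>i<n. a i (e (p i))) * (signof p * fdet n (\<lambda>i j. b (e i) j)))"
    proof (rule sum.cong[OF refl])
      fix p assume "p \<in> ?P"
      then have "fdet n (\<lambda>i j. b ((\<lambda>i\<in>{..<n}. e (p i)) i) j) = signof p * fdet n (\<lambda>i j. b (e i) j)"
        using fdet_permute_rows[of p n "\<lambda>i. b (e i)"] by (subst fdet_cong) auto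
      then show "?h (\<lambda>i\<in>{..<n}. e (p i)) =
          (\<Prod>i<n. a i (e (p i))) * (signof p * fdet n (\<lambda>i j. b (e i) j))"
        by simp
    qed
    then show "(\<Sum>p\<in>?P. ?h (\<lambda>i\<in>{..<n}. e (p i))) =
        fdet n (\<lambda>i j. a i (e j)) * fdet n (\<lambda>i j. b (e i) j)"
      by (simp add: fdet_leibniz[of n "\<lambda>i j. a i (e j)"] sum_distrib_left sum_distrib_right algebra_simps)
  qed
  finally show ?thesis .
qed

section \<open>Power series graded by total degree\<close>

lemma mps_coeff_simps [simp]:
  "mps_coeff 0 M = 0"
  "mps_coeff 1 M = (if M = {#} then 1 else 0)"
  "mps_coeff (f + g) M = mps_coeff f M + mps_coeff g M"
  "mps_coeff (f - g) M = mps_coeff f M - mps_coeff g M"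
  "mps_coeff (- f) M = - mps_coeff f M"
  "mps_coeff (mps_const c) M = (if M = {#} then c else 0)"
  "mps_coeff (mps_var i) M = (if M = {#i#} then 1 else 0)"
  by (simp_all add: zero_mps_def one_mps_def plus_mps_def minus_mps_def uminus_mps_def
      mps_const_def mps_var_def)

lemma mps_coeff_mult:
  "mps_coeff (f * g) M = (\<Sum>(A, B)\<in>msplits M. mps_coeff f A * mps_coeff g B)"
  by (simp add: times_mps_def)

lemma mps_coeff_sum: "mps_coeff (\<Sum>i\<in>I. f i) M = (\<Sum>i\<in>I. mps_coeff (f i) M)"
  by (induction I rule: infinite_finite_induct) simp_all

lemma mps_const_inject: "mps_const c = mps_const d \<longleftrightarrow> c = d"
  by (auto simp: mps_const_def mps_eq_iff)

lemma mps_const_add: "mps_const (c + d) = mps_const c + (mps_const d :: 'a::comm_ring_1 mps)"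
  by (simp add: mps_eq_iff)

lemma mps_const_minus: "mps_const (c - d) = mps_const c - (mps_const d :: 'a::comm_ring_1 mps)"
  by (simp add: mps_eq_iff)

lemma mps_const_1: "mps_const 1 = (1 :: 'a::comm_ring_1 mps)"
  by (simp add: mps_eq_iff)

lemma mps_const_0: "mps_const 0 = (0 :: 'a::comm_ring_1 mps)"
  by (simp add: mps_eq_iff)

lemma mps_const_mult: "mps_const (c * d) = mps_const c * (mps_const d :: 'a::comm_ring_1 mps)"
proof (rule mps_eqI)
  fix M
  have "mps_coeff (mps_const c * mps_const d) M =
      (\<Sum>(A, B)\<in>(if M = {#} then {({#}, {#})} else {}). mps_coeff (mps_const c) A * mps_coeff (mps_const d) B)"
    unfolding mps_coeff_mult by (rule sum.mono_neutral_right) auto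
  then show "mps_coeff (mps_const (c * d)) M = mps_coeff (mps_const c * mps_const d) M"
    by simp
qed

text \<open>Only the variables of the series count; the coefficient ring, which will contain
  \<open>t\<close> and the \<open>y\<close> variables, has degree 0. The zero series is homogeneous
  of every degree.\<close>

definition homog :: "nat \<Rightarrow> 'a::zero mps \<Rightarrow> bool" where
  "homog d f \<longleftrightarrow> (\<forall>M. mps_coeff f M \<noteq> 0 \<longrightarrow> size M = d)"

lemma homogD: "homog d f \<Longrightarrow> size M \<noteq> d \<Longrightarrow> mps_coeff f M = 0"
  by (auto simp: homog_def)

lemma homogI: "(\<And>M. size M \<noteq> d \<Longrightarrow> mps_coeff f M = 0) \<Longrightarrow> homog d f"
  by (auto simp: homog_def)

lemma homog_simps [simp]:
  "homog d (0 :: 'a::comm_ring_1 mps)"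
  "homog 0 (1 :: 'a mps)"
  "homog 0 (mps_const c)"
  "homog 1 (mps_var i :: 'a mps)"
  by (auto simp: homog_def mps_const_def mps_var_def)

lemma homog_add: "homog d f \<Longrightarrow> homog d g \<Longrightarrow> homog d (f + g :: 'a::comm_ring_1 mps)"
  by (rule homogI) (simp add: homogD)

lemma homog_diff: "homog d f \<Longrightarrow> homog d g \<Longrightarrow> homog d (f - g :: 'a::comm_ring_1 mps)"
  by (rule homogI) (simp add: homogD)

lemma homog_uminus: "homog d f \<Longrightarrow> homog d (- f :: 'a::comm_ring_1 mps)"
  by (simp add: homog_def)

lemma homog_mult:
  assumes "homog d f" "homog e g"
  shows "homog (d + e) (f * g :: 'a::comm_ring_1 mps)"
  unfolding homog_def
proof (intro allI impI)
  fix M assume "mps_coeff (f * g) M \<noteq> 0"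
  then obtain A B where "A + B = M" "mps_coeff f A * mps_coeff g B \<noteq> 0"
    unfolding mps_coeff_mult by (auto elim!: sum.not_neutral_contains_not_neutral)
  then show "size M = d + e"
    using homogD[OF assms(1), of A] homogD[OF assms(2), of B] by fastforce
qed

lemma homog_sum: "(\<And>i. i \<in> I \<Longrightarrow> homog d (f i)) \<Longrightarrow> homog d (\<Sum>i\<in>I. f i :: 'a::comm_ring_1 mps)"
  by (induction I rule: infinite_finite_induct) (auto intro: homog_add)

lemma homog_prod:
  "(\<And>i. i \<in> I \<Longrightarrow> homog (d i) (f i)) \<Longrightarrow> homog (\<Sum>i\<in>I. d i) (\<Prod>i\<in>I. f i :: 'a::comm_ring_1 mps)"
  by (induction I rule: infinite_finite_induct) (auto intro: homog_mult)

lemma homog_power: "homog d f \<Longrightarrow> homog (k * d) (f ^ k :: 'a::comm_ring_1 mps)"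
  by (induction k) (auto intro: homog_mult)

lemma homog_mult_0: "homog 0 f \<Longrightarrow> homog d g \<Longrightarrow> homog d (f * g :: 'a::comm_ring_1 mps)"
  using homog_mult[of 0 f d g] by simp

lemma homog_power_1: "homog 1 f \<Longrightarrow> homog k (f ^ k :: 'a::comm_ring_1 mps)"
  using homog_power[of 1 f k] by simp

lemma homog_power_0: "homog 0 f \<Longrightarrow> homog 0 (f ^ k :: 'a::comm_ring_1 mps)"
  using homog_power[of 0 f k] by simp

text \<open>Each Leibniz term takes exactly one entry from every column, so degrees attached to
  columns have the same total for all permutations.\<close>

lemma homog_fdet:
  assumes "\<And>i j. i < n \<Longrightarrow> j < n \<Longrightarrow> homog (d j) (a i j)"
  shows "homog (\<Sum>j<n. d j) (fdet n a :: 'a::comm_ring_1 mps)"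
  unfolding fdet_leibniz
proof (rule homog_sum)
  fix p assume "p \<in> {p. p permutes {..<n}}"
  then have p: "p permutes {..<n}" by simp
  have "homog (\<Sum>i<n. d (p i)) (\<Prod>i<n. a i (p i))"
    using permutes_in_image[OF p] by (intro homog_prod assms) auto
  moreover have "(\<Sum>i<n. d (p i)) = (\<Sum>j<n. d j)"
    using p by (rule sum.permute[symmetric, unfolded o_def])
  moreover have "homog 0 (signof p :: 'a mps)"
    by (simp add: sign_def homog_uminus)
  ultimately show "homog (\<Sum>j<n. d j) (signof p * (\<Prod>i<n. a i (p i)))"
    by (simp only: homog_mult_0)
qed

text \<open>Congruence modulo the ideal of series of order at least \<open>K\<close>. It respects
  sums, products and determinants, and congruence for all \<open>K\<close> is equality.\<close>

definition eq_upto :: "nat \<Rightarrow> 'a mps \<Rightarrow> 'a mps \<Rightarrow> bool" where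
  "eq_upto K f g \<longleftrightarrow> (\<forall>M. size M < K \<longrightarrow> mps_coeff f M = mps_coeff g M)"

lemma eq_upto_refl [simp]: "eq_upto K f f"
  by (simp add: eq_upto_def)

lemma eq_upto_trans [trans]: "eq_upto K f g \<Longrightarrow> eq_upto K g h \<Longrightarrow> eq_upto K f h"
  by (simp add: eq_upto_def)

lemma eq_upto_sym: "eq_upto K f g \<Longrightarrow> eq_upto K g f"
  by (simp add: eq_upto_def)

lemma eq_upto_mono: "eq_upto K f g \<Longrightarrow> L \<le> K \<Longrightarrow> eq_upto L f g"
  by (simp add: eq_upto_def)

lemma eq_upto_imp_eq: "(\<And>K. eq_upto K f g) \<Longrightarrow> f = g"
  unfolding eq_upto_def by (rule mps_eqI) blast

lemma eq_upto_add:
  "eq_upto K f f' \<Longrightarrow> eq_upto K g g' \<Longrightarrow> eq_upto K (f + g) (f' + g' :: 'a::comm_ring_1 mps)"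
  by (simp add: eq_upto_def)

lemma eq_upto_mult:
  assumes "eq_upto K f f'" "eq_upto K g g'"
  shows "eq_upto K (f * g) (f' * g' :: 'a::comm_ring_1 mps)"
  unfolding eq_upto_def mps_coeff_mult
proof (intro allI impI sum.cong[OF refl], clarsimp)
  fix A B :: "nat multiset" assume "size A + size B < K"
  then show "mps_coeff f A * mps_coeff g B = mps_coeff f' A * mps_coeff g' B"
    using assms by (simp add: eq_upto_def)
qed

lemma eq_upto_sum:
  "(\<And>i. i \<in> I \<Longrightarrow> eq_upto K (f i) (g i)) \<Longrightarrow>
    eq_upto K (\<Sum>i\<in>I. f i) (\<Sum>i\<in>I. g i :: 'a::comm_ring_1 mps)"
  by (induction I rule: infinite_finite_induct) (auto intro: eq_upto_add)

lemma eq_upto_prod: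
  "(\<And>i. i \<in> I \<Longrightarrow> eq_upto K (f i) (g i)) \<Longrightarrow>
    eq_upto K (\<Prod>i\<in>I. f i) (\<Prod>i\<in>I. g i :: 'a::comm_ring_1 mps)"
  by (induction I rule: infinite_finite_induct) (auto intro: eq_upto_mult)

lemma eq_upto_fdet:
  assumes "\<And>i j. i < n \<Longrightarrow> j < n \<Longrightarrow> eq_upto K (a i j) (b i j)"
  shows "eq_upto K (fdet n a) (fdet n b :: 'a::comm_ring_1 mps)"
  unfolding fdet_leibniz
proof (intro eq_upto_sum eq_upto_mult eq_upto_refl eq_upto_prod)
  fix p i assume "p \<in> {p. p permutes {..<n}}" "i \<in> {..<n}"
  then show "eq_upto K (a i (p i)) (b i (p i))"
    using permutes_in_image[of p "{..<n}" i] by (intro assms) auto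
qed

lemma eq_upto_homog_mult_0:
  assumes "homog d f" "K \<le> d"
  shows "eq_upto K (f * g) (0 :: 'a::comm_ring_1 mps)"
proof -
  have "eq_upto K f 0"
    using assms by (auto simp: eq_upto_def intro: homogD)
  then show ?thesis
    using eq_upto_mult[of K f 0 g g] by simp
qed

text \<open>
  If \<open>h\<close> denotes the part of \<open>g\<close> outside degree \<open>d\<close>, then \<open>D * h\<close> has no component of
  degree \<open>e + d\<close>, while \<open>D * g\<close> and \<open>D * (g - h)\<close> have only that component; so \<open>D * h = 0\<close>.
\<close>

lemma homog_cancel:
  fixes D g :: "'a::idom mps"
  assumes "D \<noteq> 0" "homog e D" "homog (e + d) (D * g)"
  shows "homog d g"
proof -
  define h where "h = Abs_mps (\<lambda>M. if size M = d then 0 else mps_coeff g M)"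
  have "homog d (g - h)"
    by (auto simp: homog_def h_def)
  then have "homog (e + d) (D * (g - h))"
    by (intro homog_mult assms)
  with assms(3) have "homog (e + d) (D * g - D * (g - h))"
    by (rule homog_diff)
  then have hom: "homog (e + d) (D * h)"
    by (simp add: algebra_simps)
  have "D * h = 0"
  proof (rule mps_eqI)
    fix M
    show "mps_coeff (D * h) M = mps_coeff 0 M"
    proof (cases "size M = e + d")
      case True
      have "mps_coeff D A * mps_coeff h B = 0" if "A + B = M" for A B
      proof (cases "size A = e")
        case sA: True
        then have "size B = d" using that True by auto
        then show ?thesis by (simp add: h_def)
      next
        case False
        then show ?thesis using homogD[OF assms(2)] by simp
      qed
      then show ?thesis
        by (auto simp: mps_coeff_mult intro!: sum.neutral)
    next
      case False
      then show ?thesis using homogD[OF hom] by simp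
    qed
  qed
  then have "h = 0" using assms(1) by simp
  then show ?thesis using \<open>homog d (g - h)\<close> by simp
qed

text \<open>The infinite sum of the \<open>f d\<close> when each \<open>f d\<close> is homogeneous
  of degree \<open>d\<close>: only the summand with index \<open>size M\<close> can then contribute
  at \<open>M\<close>, and no notion of limit is required.\<close>

definition graded_sum :: "(nat \<Rightarrow> 'a mps) \<Rightarrow> 'a mps" where
  "graded_sum f = Abs_mps (\<lambda>M. mps_coeff (f (size M)) M)"

lemma eq_upto_graded_sum:
  fixes f :: "nat \<Rightarrow> 'a::comm_ring_1 mps"
  assumes "\<And>d. homog d (f d)"
  shows "eq_upto K (graded_sum f) (\<Sum>d<K. f d)"
  unfolding eq_upto_def
proof (intro allI impI)
  fix M :: "nat multiset" assume "size M < K"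
  then have "(\<Sum>d<K. mps_coeff (f d) M) = (\<Sum>d\<in>{size M}. mps_coeff (f d) M)"
    by (intro sum.mono_neutral_right) (auto intro: homogD[OF assms])
  then show "mps_coeff (graded_sum f) M = mps_coeff (\<Sum>d<K. f d) M"
    by (simp add: graded_sum_def mps_coeff_sum)
qed

text \<open>Intended for \<open>g i\<close> homogeneous of degree \<open>deg i\<close> with finitely
  many members in each degree, so that every inner sum is finite.\<close>

definition family_sum :: "('b \<Rightarrow> nat) \<Rightarrow> ('b \<Rightarrow> 'a::comm_ring_1 mps) \<Rightarrow> 'b set \<Rightarrow> 'a mps" where
  "family_sum deg g I = graded_sum (\<lambda>d. \<Sum>i\<in>{i\<in>I. deg i = d}. g i)"

lemma mps_coeff_family_sum:
  "mps_coeff (family_sum deg g I) M = (\<Sum>i\<in>{i\<in>I. deg i = size M}. mps_coeff (g i) M)"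
  by (simp add: family_sum_def graded_sum_def mps_coeff_sum)

text \<open>A monomial \<open>M\<close> occurs only in members of degree \<open>size M\<close>, and
  there are finitely many of these.\<close>

lemma has_formal_sum_family_sum:
  fixes g :: "'b \<Rightarrow> 'a::idom mps"
  assumes "\<And>i. i \<in> I \<Longrightarrow> homog (deg i) (g i)"
    and "\<And>d. finite {i\<in>I. deg i = d}"
    and "\<And>i. i \<in> I \<Longrightarrow> f i = to_fract (g i)"
  shows "has_formal_sum f I (to_fract (family_sum deg g I))"
  unfolding has_formal_sum_def
proof (intro exI conjI ballI allI)
  fix M
  have sub: "{i\<in>I. mps_coeff (g i) M \<noteq> 0} \<subseteq> {i\<in>I. deg i = size M}"
    using assms(1) by (auto simp: homog_def)
  then show "finite {i\<in>I. mps_coeff (g i) M \<noteq> 0}"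
    using assms(2) finite_subset by blast
  show "mps_coeff (family_sum deg g I) M = (\<Sum>i\<in>{i\<in>I. mps_coeff (g i) M \<noteq> 0}. mps_coeff (g i) M)"
    unfolding mps_coeff_family_sum by (rule sum.mono_neutral_right) (use sub assms(2) in auto)
qed (use assms in auto)

text \<open>Members of degree at least \<open>K\<close> are invisible below degree \<open>K\<close>,
  so \<open>J\<close> may contain any of them. This freedom allows a cut-off by exponents instead of
  by weight.\<close>

lemma eq_upto_family_sum:
  fixes g :: "'b \<Rightarrow> 'a::comm_ring_1 mps"
  assumes "\<And>i. i \<in> I \<Longrightarrow> homog (deg i) (g i)"
    and "finite J" "J \<subseteq> I" "{i\<in>I. deg i < K} \<subseteq> J"
  shows "eq_upto K (family_sum deg g I) (\<Sum>i\<in>J. g i)"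
  unfolding eq_upto_def mps_coeff_family_sum mps_coeff_sum
proof (intro allI impI sum.mono_neutral_left ballI)
  fix M :: "nat multiset" and i
  assume "size M < K"
  then show "{i \<in> I. deg i = size M} \<subseteq> J" using assms by auto
  assume "i \<in> J - {i \<in> I. deg i = size M}"
  then show "mps_coeff (g i) M = 0"
    using assms by (auto intro!: homogD[of "deg i"])
qed (use assms in auto)

section \<open>Chebyshev polynomials of the second kind\<close>

text \<open>Normalised so that \<open>U\<^sub>m(y + 1/y) = (y\<^bsup>m+1\<^esup> - y\<^bsup>-m-1\<^esup>) / (y - 1/y)\<close>.\<close>

fun chebU :: "nat \<Rightarrow> 'a::comm_ring_1 poly" where
  "chebU 0 = 1"
| "chebU (Suc 0) = [:0, 1:]"
| "chebU (Suc (Suc m)) = [:0, 1:] * chebU (Suc m) - chebU m"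

text \<open>Both sides satisfy the recurrence of \<open>chebU\<close> at \<open>y + y'\<close>.
  Using a pair with product 1 instead of an inverse makes this available in the ring of
  series.\<close>

lemma chebU_inverse_pair:
  fixes y y' :: "'a::comm_ring_1"
  assumes "y * y' = 1"
  shows "(y - y') * poly (chebU m) (y + y') = y ^ Suc m - y' ^ Suc m"
proof (induction m rule: chebU.induct)
  case (3 m)
  have "(y - y') * poly (chebU (Suc (Suc m))) (y + y') =
      (y + y') * ((y - y') * poly (chebU (Suc m)) (y + y')) - (y - y') * poly (chebU m) (y + y')"
    by (simp add: algebra_simps)
  \<comment> \<open>The factor \<open>y * y'\<close>, equal to 1, is inserted so that the mixed
    terms cancel.\<close>
  also have "\<dots> = (y + y') * (y ^ Suc (Suc m) - y' ^ Suc (Suc m)) - (y * y') * (y ^ Suc m - y' ^ Suc m)"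
    unfolding 3 assms by simp
  also have "\<dots> = y ^ Suc (Suc (Suc m)) - y' ^ Suc (Suc (Suc m))"
    by (simp add: algebra_simps)
  finally show ?case .
qed (simp_all add: algebra_simps)

text \<open>The recurrence telescopes the sum. The error is an explicit multiple of
  \<open>x ^ Suc K\<close>, hence negligible below degree \<open>K + 1\<close> when \<open>x\<close>
  has degree 1.\<close>

lemma chebU_partial_sum:
  fixes x z :: "'a::comm_ring_1"
  shows "(1 - x * z + x^2) * (\<Sum>l<Suc K. x ^ l * poly (chebU l) z) =
    1 - x ^ Suc K * (poly (chebU (Suc K)) z - x * poly (chebU K) z)"
proof (induction K)
  case 0
  then show ?case by (simp add: algebra_simps power2_eq_square)
next
  case (Suc K)
  have "(1 - x * z + x^2) * (\<Sum>l<Suc (Suc K). x ^ l * poly (chebU l) z) =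
      1 - x ^ Suc K * (poly (chebU (Suc K)) z - x * poly (chebU K) z) +
      (1 - x * z + x^2) * (x ^ Suc K * poly (chebU (Suc K)) z)"
    by (subst sum.lessThan_Suc, subst distrib_left, subst Suc) simp
  also have "\<dots> = 1 - x ^ Suc (Suc K) * (poly (chebU (Suc (Suc K))) z - x * poly (chebU (Suc K)) z)"
    by (simp add: algebra_simps power2_eq_square)
  finally show ?case .
qed

lemma homog_chebU:
  fixes z :: "'a::comm_ring_1 mps"
  assumes "homog 0 z"
  shows "homog 0 (poly (chebU m) z)"
  by (induction m rule: chebU.induct) (auto intro!: homog_diff homog_mult_0 assms)

text \<open>The factor \<open>1 - t ^ Suc l\<close> splits the series into the Chebyshev generating
  function at \<open>x\<close> minus \<open>t\<close> times the one at \<open>t * x\<close>. Over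
  the common denominator the numerator is
  \<open>?Q2 - t * ?Q1 = (1 - t) * (1 - t * x^2)\<close>.\<close>

lemma chebU_generating_function:
  fixes x z t :: "'a::comm_ring_1 mps"
  assumes "homog 1 x" "homog 0 z" "homog 0 t"
  shows "(1 - x * z + x^2) * (1 - t * x * z + (t * x)^2) *
      graded_sum (\<lambda>l. x ^ l * ((1 - t ^ Suc l) * poly (chebU l) z)) = (1 - t) * (1 - t * x^2)"
    (is "?Q1 * ?Q2 * graded_sum ?f = _")
proof (rule eq_upto_imp_eq)
  fix K
  let ?U = "\<lambda>l. poly (chebU l) z"
  let ?S = "\<lambda>x. \<Sum>l<Suc K. x ^ l * ?U l"
  \<comment> \<open>The errors of the two partial sums, with the common factor
    \<open>x ^ Suc K\<close> taken out.\<close>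
  define R where "R = ?Q2 * (?U (Suc K) - x * ?U K) - ?Q1 * t ^ Suc (Suc K) * (?U (Suc K) - t * x * ?U K)"
  have "homog l (?f l)" for l
    using homog_mult[OF homog_power_1[OF assms(1)], of 0 "(1 - t ^ Suc l) * ?U l" l]
    by (simp add: homog_mult_0 homog_diff homog_chebU homog_power_0 assms del: power_Suc)
  then have "eq_upto (Suc K) (?Q1 * ?Q2 * graded_sum ?f) (?Q1 * ?Q2 * (\<Sum>l<Suc K. ?f l))"
    by (intro eq_upto_mult eq_upto_refl eq_upto_graded_sum)
  also have "(\<Sum>l<Suc K. ?f l) = ?S x - t * ?S (t * x)"
    by (simp add: sum_subtractf sum_distrib_left power_mult_distrib algebra_simps del: sum.lessThan_Suc)
  also have "?Q1 * ?Q2 * (?S x - t * ?S (t * x)) = ?Q2 * (?Q1 * ?S x) - t * ?Q1 * (?Q2 * ?S (t * x))"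
    by (simp only: algebra_simps)
  also have "\<dots> = ?Q2 * (1 - x ^ Suc K * (?U (Suc K) - x * ?U K)) -
      t * ?Q1 * (1 - (t * x) ^ Suc K * (?U (Suc K) - t * x * ?U K))"
    by (simp only: chebU_partial_sum)
  also have "\<dots> = (1 - t) * (1 - t * x^2) - x ^ Suc K * R"
    unfolding R_def power_mult_distrib by (simp add: algebra_simps power2_eq_square del: chebU.simps)
  also have "eq_upto (Suc K) \<dots> ((1 - t) * (1 - t * x^2))"
  proof -
    have "eq_upto (Suc K) (x ^ Suc K * (- R)) 0"
      by (rule eq_upto_homog_mult_0[OF homog_power_1[OF assms(1)]]) simp
    from eq_upto_add[OF eq_upto_refl this, of "(1 - t) * (1 - t * x^2)"] show ?thesis
      by simp
  qed
  finally show "eq_upto K (?Q1 * ?Q2 * graded_sum ?f) ((1 - t) * (1 - t * x^2))"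
    by (rule eq_upto_mono) simp
qed

section \<open>Partitions and strictly decreasing exponents\<close>

definition partitions_upto :: "nat \<Rightarrow> nat list set" where
  "partitions_upto n = {lam. is_partition lam \<and> length lam \<le> n}"

definition weight :: "nat \<Rightarrow> nat list \<Rightarrow> nat" where
  "weight n lam = (\<Sum>i<n. part lam (Suc i))"

text \<open>The subtraction does not truncate, as \<open>i < n\<close>. The restriction makes the
  function extensional, matching \<open>decreasing_seqs\<close>.\<close>

definition exponents :: "nat \<Rightarrow> nat list \<Rightarrow> nat \<Rightarrow> nat" where
  "exponents n lam = (\<lambda>i\<in>{..<n}. part lam (Suc i) + n - Suc i)"

lemma part_antimono:
  assumes "is_partition lam" "i \<le> j"
  shows "part lam (Suc j) \<le> part lam (Suc i)"
proof (cases "i = j \<or> length lam \<le> j")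
  case True
  then show ?thesis by (auto simp: part_def)
next
  case False
  then show ?thesis
    using assms by (auto simp: part_def is_partition_def sorted_wrt_iff_nth_less)
qed

text \<open>A longer \<open>mu\<close> would have a positive part where \<open>lam\<close> is padded
  with 0.\<close>

lemma partition_length_le:
  assumes "lam \<in> partitions_upto n" "mu \<in> partitions_upto n"
    and "\<And>i. i < n \<Longrightarrow> part lam (Suc i) = part mu (Suc i)"
  shows "length mu \<le> length lam"
proof (rule ccontr)
  assume "\<not> length mu \<le> length lam"
  then have less: "length lam < length mu" by simp
  then have "mu ! length lam > 0" "length lam < n"
    using assms(2) by (auto simp: partitions_upto_def is_partition_def)
  then show False
    using assms(3)[of "length lam"] less by (simp add: part_def)
qed

lemma partition_eqI:
  assumes "lam \<in> partitions_upto n" "mu \<in> partitions_upto n"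
    and "\<And>i. i < n \<Longrightarrow> part lam (Suc i) = part mu (Suc i)"
  shows "lam = mu"
proof (rule nth_equalityI)
  show len: "length lam = length mu"
    using partition_length_le[OF assms] partition_length_le[OF assms(2,1)] assms(3)
    by (simp add: antisym)
  fix i assume "i < length lam"
  then show "lam ! i = mu ! i"
    using assms(1) assms(3)[of i] len by (auto simp: part_def partitions_upto_def)
qed

text \<open>Every step descends by at least 1. With \<open>j = n - 1\<close> this gives
  \<open>e i\<close> at least \<open>n - 1 - i\<close>, so the staircase can be subtracted from
  \<open>e\<close>.\<close>

lemma decreasing_seqs_gap:
  assumes "e \<in> decreasing_seqs n K" "i \<le> j" "j < n"
  shows "e j + (j - i) \<le> e i"
  using assms(2,3)
proof (induction j rule: dec_induct)
  case (step m)
  then have "e (Suc m) < e m"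
    using assms(1) by (auto simp: decreasing_seqs_def)
  with step show ?case by auto
qed simp

text \<open>The inverse subtracts the staircase \<open>n - Suc i\<close> and drops the trailing
  zeros.\<close>

lemma bij_betw_exponents:
  "bij_betw (exponents n) {lam \<in> partitions_upto n. \<forall>i<n. exponents n lam i < K} (decreasing_seqs n K)"
proof (rule bij_betw_imageI)
  show "inj_on (exponents n) {lam \<in> partitions_upto n. \<forall>i<n. exponents n lam i < K}"
  proof (rule inj_onI)
    fix lam mu
    assume lam: "lam \<in> {lam \<in> partitions_upto n. \<forall>i<n. exponents n lam i < K}"
      and mu: "mu \<in> {lam \<in> partitions_upto n. \<forall>i<n. exponents n lam i < K}"
      and eq: "exponents n lam = exponents n mu"
    show "lam = mu"
    proof (rule partition_eqI[of _ n])
      fix i assume "i < n"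
      then show "part lam (Suc i) = part mu (Suc i)"
        using fun_cong[OF eq, of i] by (simp add: exponents_def)
    qed (use lam mu in auto)
  qed
next
  show "exponents n ` {lam \<in> partitions_upto n. \<forall>i<n. exponents n lam i < K} = decreasing_seqs n K"
  proof (intro equalityI subsetI)
    fix e assume "e \<in> exponents n ` {lam \<in> partitions_upto n. \<forall>i<n. exponents n lam i < K}"
    then obtain lam where lam: "is_partition lam" "\<forall>i<n. exponents n lam i < K"
      and e: "e = exponents n lam"
      by (auto simp: partitions_upto_def)
    have "e j < e i" if "i < j" "j < n" for i j
      using part_antimono[OF lam(1), of i j] that by (simp add: e exponents_def)
    then show "e \<in> decreasing_seqs n K"
      using lam(2) by (auto simp: decreasing_seqs_def e exponents_def)
  next
    fix e assume e: "e \<in> decreasing_seqs n K"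
    define f where "f i = e i - (n - Suc i)" for i
    have e_eq: "e i = f i + (n - Suc i)" if "i < n" for i
      using decreasing_seqs_gap[OF e, of i "n - 1"] that unfolding f_def by linarith
    have f_mono: "f j \<le> f i" if "i \<le> j" "j < n" for i j
      using decreasing_seqs_gap[OF e that] that unfolding f_def by auto
    \<comment> \<open>The number of non-zero parts; the alternative \<open>k = n\<close> provides a
      value when no entry below \<open>n\<close> vanishes.\<close>
    define k where "k = (LEAST k. k = n \<or> f k = 0)"
    have k: "k = n \<or> f k = 0"
      unfolding k_def by (rule LeastI[of _ n]) simp
    have "k \<le> n"
      unfolding k_def by (rule Least_le) simp
    have f_pos: "f i > 0" if "i < k" for i
      using not_less_Least[OF that[unfolded k_def]] by simp
    define lam where "lam = map f [0..<k]"
    have lam: "lam \<in> partitions_upto n"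
      using \<open>k \<le> n\<close> f_pos f_mono
      by (auto simp: partitions_upto_def is_partition_def lam_def sorted_wrt_iff_nth_less)
    have "part lam (Suc i) = f i" if "i < n" for i
      using that k f_mono[of k i] \<open>k \<le> n\<close> by (auto simp: part_def lam_def)
    then have exp: "exponents n lam = e"
      using e e_eq by (auto simp: exponents_def decreasing_seqs_def fun_eq_iff extensional_def PiE_def)
    moreover have "\<forall>i<n. exponents n lam i < K"
      using e by (auto simp: exp decreasing_seqs_def)
    ultimately show "e \<in> exponents n ` {lam \<in> partitions_upto n. \<forall>i<n. exponents n lam i < K}"
      using lam by blast
  qed
qed

lemma finite_decreasing_seqs: "finite (decreasing_seqs n K)"
  by (rule finite_subset[of _ "{..<n} \<rightarrow>\<^sub>E {..<K}"]) (auto simp: decreasing_seqs_def intro: finite_PiE)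

lemma part_le_weight: "i < n \<Longrightarrow> part lam (Suc i) \<le> weight n lam"
  unfolding weight_def by (rule member_le_sum) auto

lemma finite_partitions_weight: "finite {lam \<in> partitions_upto n. weight n lam = d}"
proof (rule finite_subset)
  show "{lam \<in> partitions_upto n. weight n lam = d} \<subseteq> {xs. set xs \<subseteq> {..d} \<and> length xs \<le> n}"
  proof
    fix lam assume "lam \<in> {lam \<in> partitions_upto n. weight n lam = d}"
    then have lam: "length lam \<le> n" "weight n lam = d"
      by (auto simp: partitions_upto_def)
    have "lam ! i \<le> d" if "i < length lam" for i
      using part_le_weight[of i n lam] that lam by (simp add: part_def)
    then show "lam \<in> {xs. set xs \<subseteq> {..d} \<and> length xs \<le> n}"
      using lam by (auto simp: set_conv_nth)
  qed
qed (simp add: finite_lists_length_le)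

text \<open>The staircase contributes the degree of the Vandermonde product, so the weight is the
  degree left after division.\<close>

lemma sum_exponents: "(\<Sum>j<n. exponents n lam j) = (\<Sum>j<n. j) + weight n lam"
proof -
  have "(\<Sum>j<n. exponents n lam j) = (\<Sum>j<n. part lam (Suc j) + (n - Suc j))"
    by (rule sum.cong) (auto simp: exponents_def)
  also have "\<dots> = weight n lam + (\<Sum>j<n. j)"
    unfolding sum.distrib weight_def using sum.nat_diff_reindex[of "\<lambda>j. j" n] by simp
  finally show ?thesis by simp
qed

section \<open>The identity for power series\<close>

lemma homog_vandermonde:
  fixes x :: "nat \<Rightarrow> 'a::comm_ring_1 mps"
  assumes "\<And>i. homog d (x i)"
  shows "homog (\<Sum>j<n. j * d) (\<Prod>j<n. \<Prod>i<j. x i - x j)"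
proof (rule homog_prod)
  fix j
  have "homog (\<Sum>i<j. d) (\<Prod>i<j. x i - x j)"
    by (intro homog_prod homog_diff assms)
  then show "homog (j * d) (\<Prod>i<j. x i - x j)" by simp
qed

context
  fixes x z :: "nat \<Rightarrow> 'a::idom mps" and t :: "'a mps" and n :: nat and gx gz :: "nat list \<Rightarrow> 'a mps"
  assumes hom_x: "\<And>i. homog 1 (x i)" and hom_z: "\<And>i. homog 0 (z i)" and hom_t: "homog 0 t"
    and Vx_nz: "(\<Prod>j<n. \<Prod>i<j. x i - x j) \<noteq> 0"
    and Vz_nz: "(\<Prod>j<n. \<Prod>i<j. z i - z j) \<noteq> 0"
    and gx: "\<And>lam. (\<Prod>j<n. \<Prod>i<j. x i - x j) * gx lam = fdet n (\<lambda>i j. x i ^ exponents n lam j)"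
    and gz: "\<And>lam. (\<Prod>j<n. \<Prod>i<j. z i - z j) * gz lam =
      fdet n (\<lambda>i j. poly (chebU (exponents n lam j)) (z i))"
begin

text \<open>\<open>gx lam\<close> and \<open>gz lam\<close> stand for the Schur polynomial and the
  symplectic character, specified through their products with the Vandermonde products to avoid
  division of series.\<close>

definition cauchy_term :: "nat list \<Rightarrow> 'a mps" where
  "cauchy_term lam = (\<Prod>i<n. 1 - t ^ Suc (exponents n lam i)) * gx lam * gz lam"

text \<open>The degrees of the alternants and of the Vandermonde products are known, and
  \<open>homog_cancel\<close> passes them to the quotients. Only the quotient in \<open>x\<close>
  contributes to the degree.\<close>

lemma homog_cauchy_term: "homog (weight n lam) (cauchy_term lam)"
proof -
  have "homog (weight n lam) (gx lam)"
  proof (rule homog_cancel[OF Vx_nz])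
    show "homog (\<Sum>j<n. j) (\<Prod>j<n. \<Prod>i<j. x i - x j)"
      using homog_vandermonde[of 1 x n, OF hom_x] by simp
    show "homog ((\<Sum>j<n. j) + weight n lam) ((\<Prod>j<n. \<Prod>i<j. x i - x j) * gx lam)"
      unfolding gx sum_exponents[symmetric] by (intro homog_fdet homog_power_1 hom_x)
  qed
  moreover have "homog 0 (gz lam)"
  proof (rule homog_cancel[OF Vz_nz])
    show "homog 0 (\<Prod>j<n. \<Prod>i<j. z i - z j)"
      using homog_vandermonde[of 0 z n, OF hom_z] by simp
    have "homog (\<Sum>j<n. 0) (fdet n (\<lambda>i j. poly (chebU (exponents n lam j)) (z i)))"
      by (intro homog_fdet homog_chebU hom_z)
    then show "homog (0 + 0) ((\<Prod>j<n. \<Prod>i<j. z i - z j) * gz lam)"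
      by (simp add: gz)
  qed
  moreover have "homog (\<Sum>i<n. 0) (\<Prod>i<n. 1 - t ^ Suc (exponents n lam i))"
    by (intro homog_prod homog_diff homog_power_0 hom_t homog_simps)
  ultimately have "homog (0 + weight n lam + 0) (cauchy_term lam)"
    unfolding cauchy_term_def by (intro homog_mult) simp_all
  then show ?thesis by simp
qed

lemma cauchy_identity_mps:
  "(\<Prod>j<n. \<Prod>i<j. x i - x j) * (\<Prod>j<n. \<Prod>i<j. z i - z j) *
      family_sum (weight n) cauchy_term (partitions_upto n) =
    fdet n (\<lambda>i j. graded_sum (\<lambda>l. x i ^ l * ((1 - t ^ Suc l) * poly (chebU l) (z j))))"
    (is "?V * ?W * ?S = fdet n ?A")
proof (rule eq_upto_imp_eq)
  fix K
  \<comment> \<open>An exponent exceeds its part by at most \<open>n - 1\<close>, so the bound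
    \<open>K + n\<close> keeps all partitions of weight below \<open>K\<close>, while
    \<open>J\<close> matches a full set of decreasing sequences.\<close>
  define J where "J = {lam \<in> partitions_upto n. \<forall>i<n. exponents n lam i < K + n}"
  define b where "b l j = (1 - t ^ Suc l) * poly (chebU l) (z j)" for l j
  have bij: "bij_betw (exponents n) J (decreasing_seqs n (K + n))"
    unfolding J_def by (rule bij_betw_exponents)
  have "{lam \<in> partitions_upto n. weight n lam < K} \<subseteq> J"
  proof
    fix lam assume lam: "lam \<in> {lam \<in> partitions_upto n. weight n lam < K}"
    have "exponents n lam i < K + n" if "i < n" for i
      using part_le_weight[OF that, of lam] lam that by (auto simp: exponents_def)
    then show "lam \<in> J" using lam by (auto simp: J_def)
  qed
  then have "eq_upto K ?S (\<Sum>lam\<in>J. cauchy_term lam)"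
    using bij_betw_finite[OF bij] finite_decreasing_seqs
    by (intro eq_upto_family_sum homog_cauchy_term) (auto simp: J_def)
  then have "eq_upto K (?V * ?W * ?S) (?V * ?W * (\<Sum>lam\<in>J. cauchy_term lam))"
    by (intro eq_upto_mult eq_upto_refl)
  also have "?V * ?W * (\<Sum>lam\<in>J. cauchy_term lam) =
      (\<Sum>lam\<in>J. fdet n (\<lambda>i j. x i ^ exponents n lam j) * fdet n (\<lambda>i j. b (exponents n lam i) j))"
    unfolding sum_distrib_left
  proof (rule sum.cong[OF refl])
    fix lam
    let ?e = "exponents n lam"
    have "?V * ?W * cauchy_term lam = (\<Prod>i<n. 1 - t ^ Suc (?e i)) * ((?V * gx lam) * (?W * gz lam))"
      by (simp add: cauchy_term_def algebra_simps)
    \<comment> \<open>Transposing lets the exponents index the rows, so that the factors in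
      \<open>t\<close> can be absorbed as row factors.\<close>
    also have "\<dots> = fdet n (\<lambda>i j. x i ^ ?e j) *
        ((\<Prod>i<n. 1 - t ^ Suc (?e i)) * fdet n (\<lambda>i j. poly (chebU (?e i)) (z j)))"
      unfolding gx gz fdet_transpose[of n "\<lambda>i j. poly (chebU (?e i)) (z j)"] by (simp add: algebra_simps)
    also have "\<dots> = fdet n (\<lambda>i j. x i ^ ?e j) * fdet n (\<lambda>i j. b (?e i) j)"
      unfolding b_def fdet_scale_rows ..
    finally show "?V * ?W * cauchy_term lam = fdet n (\<lambda>i j. x i ^ ?e j) * fdet n (\<lambda>i j. b (?e i) j)" .
  qed
  also have "\<dots> = (\<Sum>e\<in>decreasing_seqs n (K + n). fdet n (\<lambda>i j. x i ^ e j) * fdet n (\<lambda>i j. b (e i) j))"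
    by (rule sum.reindex_bij_betw[OF bij])
  also have "\<dots> = fdet n (\<lambda>i j. \<Sum>l<K + n. x i ^ l * b l j)"
    by (rule cauchy_binet[symmetric])
  also have "eq_upto K \<dots> (fdet n ?A)"
  proof (rule eq_upto_fdet)
    fix i j
    have "homog l (x i ^ l * b l j)" for l
      using homog_mult[OF homog_power_1[OF hom_x], of 0 "b l j" l i]
      by (simp add: b_def homog_mult_0 homog_diff homog_chebU homog_power_0 hom_z hom_t del: power_Suc)
    then have "eq_upto (K + n) (?A i j) (\<Sum>l<K + n. x i ^ l * b l j)"
      unfolding b_def by (rule eq_upto_graded_sum)
    then show "eq_upto K (\<Sum>l<K + n. x i ^ l * b l j) (?A i j)"
      by (rule eq_upto_sym[OF eq_upto_mono]) simp
  qed
  finally show "eq_upto K (?V * ?W * ?S) (fdet n ?A)" .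
qed

end

section \<open>Passage to the fraction field\<close>

lemma dvd_quotient_function:
  assumes "\<And>a. d dvd f a"
  shows "\<exists>g. \<forall>a. d * g a = f a"
  using assms unfolding dvd_def by metis

lemma to_fract_prod: "to_fract (\<Prod>i\<in>I. f i) = (\<Prod>i\<in>I. to_fract (f i :: 'a::idom))"
  by (induction I rule: infinite_finite_induct) simp_all

lemma to_fract_power: "to_fract (f ^ k) = to_fract (f :: 'a::idom) ^ k"
  by (induction k) simp_all

lemma to_fract_fdet: "to_fract (fdet n a) = fdet n (\<lambda>i j. to_fract (a i j :: 'a::idom))"
proof -
  have "to_fract (signof p :: 'a) = signof p" for p
    by (simp add: sign_def)
  then show ?thesis
    by (simp add: fdet_leibniz to_fract_prod)
qed

lemma prod_from_1: "(\<Prod>i=1..n. f i) = (\<Prod>i<n. f (Suc i))"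
  using prod.atLeast1_atMost_eq[of f n] by simp

lemma prod_triangle_from_1: "(\<Prod>j=1..n. \<Prod>i=1..<j. f i j) = (\<Prod>j<n. \<Prod>i<j. f (Suc i) (Suc j))"
proof -
  have "(\<Prod>i=1..<Suc j. g i) = (\<Prod>i<j. g (Suc i))" for j and g :: "nat \<Rightarrow> 'a"
    unfolding One_nat_def prod.shift_bounds_Suc_ivl by (simp add: atLeast0LessThan)
  then show ?thesis
    by (simp only: prod_from_1)
qed

lemma one_div_to_fract:
  assumes "y * y' = (1 :: 'a::idom)"
  shows "1 / to_fract y = to_fract y'"
proof -
  have "to_fract y * to_fract y' = 1"
    using arg_cong[OF assms, of to_fract] by simp
  then show ?thesis
    by (metis inverse_eq_divide inverse_unique)
qed

section \<open>Laurent variables and their symmetrisations\<close>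

definition laurent_y :: "nat \<Rightarrow> laurent" where
  "laurent_y i = Poly_Mapping.single (Poly_Mapping.single i 1) 1"

definition laurent_y_inv :: "nat \<Rightarrow> laurent" where
  "laurent_y_inv i = Poly_Mapping.single (Poly_Mapping.single i (- 1)) 1"

lemma laurent_y_inverse: "laurent_y i * laurent_y_inv i = 1"
  by (simp add: laurent_y_def laurent_y_inv_def mult_single flip: single_add)

lemma laurent_y_nz: "laurent_y i - laurent_y_inv i \<noteq> 0"
proof
  assume "laurent_y i - laurent_y_inv i = 0"
  then have "Poly_Mapping.lookup (laurent_y i - laurent_y_inv i) (Poly_Mapping.single i 1) = 0"
    by simp
  then show False
    by (auto simp: laurent_y_def laurent_y_inv_def lookup_minus lookup_single when_def
        dest!: arg_cong[of _ _ "\<lambda>f. Poly_Mapping.lookup f i"] split: if_splits)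
qed

definition laurent_z :: "nat \<Rightarrow> laurent" where
  "laurent_z i = laurent_y i + laurent_y_inv i"

text \<open>The monomial with exponent 1 at \<open>i\<close> has coefficient 1 in
  \<open>laurent_z i\<close> and 0 in \<open>laurent_z j\<close>.\<close>

lemma laurent_z_neq:
  assumes "i \<noteq> j"
  shows "laurent_z i \<noteq> laurent_z j"
proof
  assume "laurent_z i = laurent_z j"
  then have eq: "Poly_Mapping.lookup (laurent_z i) (Poly_Mapping.single i 1) =
      Poly_Mapping.lookup (laurent_z j) (Poly_Mapping.single i 1)"
    by simp
  have "Poly_Mapping.single i (- 1 :: int) \<noteq> Poly_Mapping.single i 1"
    "Poly_Mapping.single j (1 :: int) \<noteq> Poly_Mapping.single i 1"
    "Poly_Mapping.single j (- 1 :: int) \<noteq> Poly_Mapping.single i 1"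
    using assms
    by (auto dest!: arg_cong[of _ _ "\<lambda>f. Poly_Mapping.lookup f i"] simp: lookup_single when_def)
  with eq show False
    by (simp add: laurent_z_def laurent_y_def laurent_y_inv_def lookup_add lookup_single_not_eq)
qed

lemma mps_coeff_mult_empty: "mps_coeff (f * g) {#} = mps_coeff f {#} * mps_coeff g {#}"
proof -
  have "msplits {#} = {({#}, {#})}"
    by (auto simp: msplits_def)
  then show ?thesis
    by (simp add: mps_coeff_mult)
qed

lemma vandermonde_nz:
  fixes x :: "nat \<Rightarrow> 'a::idom"
  assumes "\<And>i j. i \<noteq> j \<Longrightarrow> x i \<noteq> x j"
  shows "(\<Prod>j<n. \<Prod>i<j. x i - x j) \<noteq> 0"
  using assms by (auto simp: prod_zero_iff)

text \<open>This turns the double product in the symplectic denominator into a Vandermonde product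
  in the sums \<open>y + y'\<close>.\<close>

lemma inverse_pair_diff:
  fixes y y' w w' :: "'a::comm_ring_1"
  assumes "y * y' = 1" "w * w' = 1"
  shows "(y - w) * (1 - y' * w') = (y + y') - (w + w')"
proof -
  have "(y - w) * (1 - y' * w') = y - w - (y * y') * w' + (w * w') * y'"
    by (simp add: algebra_simps)
  then show ?thesis by (simp add: assms)
qed

text \<open>Each row of the numerator has the factor \<open>y i - y' i\<close>, with Chebyshev
  values as cofactors. These factors cancel against the single product in the denominator.\<close>

lemma symplectic_to_fract:
  fixes y y' :: "nat \<Rightarrow> 'a::idom"
  defines "z \<equiv> \<lambda>i. y i + y' i"
  assumes inv: "\<And>i. y i * y' i = 1" and nz: "\<And>i. y i - y' i \<noteq> 0"
    and gz: "(\<Prod>j<n. \<Prod>i<j. z (Suc i) - z (Suc j)) * g =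
      fdet n (\<lambda>i j. poly (chebU (exponents n lam j)) (z (Suc i)))"
    and Vz_nz: "(\<Prod>j<n. \<Prod>i<j. z (Suc i) - z (Suc j)) \<noteq> 0"
  shows "symplectic n lam (\<lambda>i. to_fract (y i)) = to_fract g"
proof -
  let ?V = "\<Prod>j<n. \<Prod>i<j. z (Suc i) - z (Suc j)"
  let ?Y = "\<Prod>i<n. y (Suc i) - y' (Suc i)"
  have yi: "1 / to_fract (y i) = to_fract (y' i)" for i
    using inv by (rule one_div_to_fract)
  have den: "(\<Prod>i=1..n. to_fract (y i) - 1 / to_fract (y i)) *
      (\<Prod>j=1..n. \<Prod>i=1..<j. (to_fract (y i) - to_fract (y j)) * (1 - 1 / to_fract (y i) * (1 / to_fract (y j)))) =
      to_fract (?Y * ?V)"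
    unfolding yi prod_triangle_from_1 z_def inverse_pair_diff[OF inv inv, symmetric]
    by (simp only: prod_from_1 to_fract_mult to_fract_prod to_fract_diff to_fract_1)
  have "det_from1 n (\<lambda>i j. to_fract (y i) ^ (part lam j + n + 1 - j) -
        (1 / to_fract (y i)) ^ (part lam j + n + 1 - j)) =
      fdet n (\<lambda>i j. to_fract ((y (Suc i) - y' (Suc i)) * poly (chebU (exponents n lam j)) (z (Suc i))))"
    unfolding det_from1_eq_fdet
  proof (rule fdet_cong)
    fix i j assume "i < n" "j < n"
    \<comment> \<open>The symplectic exponent is one larger than the Schur exponent, which is the
      shift in \<open>chebU_inverse_pair\<close>.\<close>
    then have "part lam (Suc j) + n + 1 - Suc j = Suc (exponents n lam j)"
      by (simp add: exponents_def)
    then show "to_fract (y (Suc i)) ^ (part lam (Suc j) + n + 1 - Suc j) -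
        (1 / to_fract (y (Suc i))) ^ (part lam (Suc j) + n + 1 - Suc j) =
        to_fract ((y (Suc i) - y' (Suc i)) * poly (chebU (exponents n lam j)) (z (Suc i)))"
      unfolding z_def chebU_inverse_pair[OF inv] by (simp only: yi to_fract_diff to_fract_power)
  qed
  also have "\<dots> = to_fract (?Y * ?V * g)"
    unfolding to_fract_fdet[symmetric] fdet_scale_rows gz[symmetric] by (simp only: mult.assoc)
  finally have num: "det_from1 n (\<lambda>i j. to_fract (y i) ^ (part lam j + n + 1 - j) -
        (1 / to_fract (y i)) ^ (part lam j + n + 1 - j)) = to_fract (?Y * ?V) * to_fract g"
    by (simp only: to_fract_mult)
  have "to_fract (?Y * ?V) \<noteq> 0"
    using nz Vz_nz by (simp add: prod_zero_iff)
  then show ?thesis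
    unfolding symplectic_def num den by simp
qed

lemma schur_to_fract:
  fixes x :: "nat \<Rightarrow> 'a::idom"
  assumes gx: "(\<Prod>j<n. \<Prod>i<j. x (Suc i) - x (Suc j)) * g = fdet n (\<lambda>i j. x (Suc i) ^ exponents n lam j)"
    and Vx_nz: "(\<Prod>j<n. \<Prod>i<j. x (Suc i) - x (Suc j)) \<noteq> 0"
  shows "schur n lam (\<lambda>i. to_fract (x i)) = to_fract g"
proof -
  let ?V = "\<Prod>j<n. \<Prod>i<j. x (Suc i) - x (Suc j)"
  have "det_from1 n (\<lambda>i j. to_fract (x i) ^ (part lam j + n - j)) =
      fdet n (\<lambda>i j. to_fract (x (Suc i) ^ exponents n lam j))"
    unfolding det_from1_eq_fdet by (rule fdet_cong) (simp add: exponents_def to_fract_power)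
  also have "\<dots> = to_fract ?V * to_fract g"
    unfolding to_fract_fdet[symmetric] gx[symmetric] by (rule to_fract_mult)
  finally have num: "det_from1 n (\<lambda>i j. to_fract (x i) ^ (part lam j + n - j)) = to_fract ?V * to_fract g" .
  have den: "(\<Prod>j=1..n. \<Prod>i=1..<j. to_fract (x i) - to_fract (x j)) = to_fract ?V"
    unfolding prod_triangle_from_1 by (simp only: to_fract_prod to_fract_diff)
  have "to_fract ?V \<noteq> 0"
    unfolding to_fract_eq_0_iff by (rule Vx_nz)
  then show ?thesis
    unfolding schur_def num den by simp
qed

theorem theorem3:
  fixes n :: nat
  assumes "n \<ge> 1"
  shows "has_formal_sum
    (\<lambda>lam. (\<Prod>i=1..n. 1 - tvar ^ (part lam i + n + 1 - i)) *
       schur n lam xvar * symplectic n lam yvar)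
    {lam. is_partition lam \<and> length lam \<le> n}
    ((\<Prod>i=1..n. 1 - tvar * xvar i ^ 2) /
     ((\<Prod>j=1..n. \<Prod>i=1..<j. xvar i - xvar j) *
      (\<Prod>j=1..n. \<Prod>i=1..<j. yvar i - yvar j) *
      (\<Prod>j=1..n. \<Prod>i=1..<j. 1 - (1 / yvar i) * (1 / yvar j))) *
     det_from1 n (\<lambda>i j. (1 - tvar) /
       ((1 - xvar i * yvar j) * (1 - tvar * xvar i * yvar j) *
        (1 - xvar i * (1 / yvar j)) * (1 - tvar * xvar i * (1 / yvar j)))))"
proof -
  define x :: "nat \<Rightarrow> laurent mps" where "x = mps_var"
  define y y' :: "nat \<Rightarrow> laurent mps"
    where "y = (\<lambda>i. mps_const (laurent_y i))" and "y' = (\<lambda>i. mps_const (laurent_y_inv i))"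
  define z where "z = (\<lambda>i. y i + y' i)"
  define t :: "laurent mps" where "t = mps_const (Poly_Mapping.single 0 [:0, 1:])"
  let ?x = "\<lambda>i. x (Suc i)" and ?z = "\<lambda>i. z (Suc i)"
  let ?Vx = "\<Prod>j<n. \<Prod>i<j. ?x i - ?x j" and ?Vz = "\<Prod>j<n. \<Prod>i<j. ?z i - ?z j"

  have vars: "xvar = (\<lambda>i. to_fract (x i))" "yvar = (\<lambda>i. to_fract (y i))" "tvar = to_fract t"
    by (auto simp: xvar_def yvar_def tvar_def x_def y_def t_def laurent_y_def)
  have inv: "y i * y' i = 1" for i
    by (simp add: y_def y'_def laurent_y_inverse mps_const_1 flip: mps_const_mult)
  have y_nz: "y i - y' i \<noteq> 0" for i
    using laurent_y_nz[of i] mps_const_inject[of "laurent_y i - laurent_y_inv i" 0]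
    by (simp add: y_def y'_def mps_const_minus mps_const_0)
  have yi: "1 / to_fract (y i) = to_fract (y' i)" for i
    using inv by (rule one_div_to_fract)
  have z_const: "z i = mps_const (laurent_z i)" for i
    by (simp add: z_def y_def y'_def laurent_z_def mps_const_add)
  have hom_x: "homog 1 (?x i)" and hom_z: "homog 0 (?z i)" and hom_t: "homog 0 t" for i
    unfolding z_const x_def t_def by (rule homog_simps)+
  have Vx_nz: "?Vx \<noteq> 0"
  proof (rule vandermonde_nz)
    fix i j :: nat assume "i \<noteq> j"
    then have "mps_coeff (?x i) {#Suc i#} \<noteq> mps_coeff (?x j) {#Suc i#}"
      by (simp add: x_def)
    then show "?x i \<noteq> ?x j" by auto
  qed
  have Vz_nz: "?Vz \<noteq> 0"
    by (rule vandermonde_nz) (simp add: z_const mps_const_inject laurent_z_neq)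

  \<comment> \<open>Monomials as column polynomials give the classical alternant.\<close>
  have "?Vx dvd fdet n (\<lambda>i j. ?x i ^ exponents n lam j)" for lam
    using vandermonde_dvd_fdet[where x = ?x and p = "\<lambda>j. monom 1 (exponents n lam j)" and n = n]
    by (simp only: poly_monom mult_1)
  from dvd_quotient_function[of _ "\<lambda>lam. fdet n (\<lambda>i j. ?x i ^ exponents n lam j)", OF this] obtain gx
    where "\<forall>lam. ?Vx * gx lam = fdet n (\<lambda>i j. ?x i ^ exponents n lam j)"
    by (elim exE)
  note gx = spec[OF this]
  have "?Vz dvd fdet n (\<lambda>i j. poly (chebU (exponents n lam j)) (?z i))" for lam
    by (rule vandermonde_dvd_fdet)
  from dvd_quotient_function[of _ "\<lambda>lam. fdet n (\<lambda>i j. poly (chebU (exponents n lam j)) (?z i))", OF this]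
  obtain gz
    where "\<forall>lam. ?Vz * gz lam = fdet n (\<lambda>i j. poly (chebU (exponents n lam j)) (?z i))"
    by (elim exE)
  note gz = spec[OF this]

  define g where "g = cauchy_term t n gx gz"
  define S where "S = family_sum (weight n) g (partitions_upto n)"
  have g: "g lam = (\<Prod>i<n. 1 - t ^ Suc (exponents n lam i)) * gx lam * gz lam" for lam
    unfolding g_def using hom_x hom_z hom_t Vx_nz Vz_nz gx gz by (rule cauchy_term_def)
  have g_hom: "homog (weight n lam) (g lam)" for lam
    unfolding g_def using hom_x hom_z hom_t Vx_nz Vz_nz gx gz by (rule homog_cauchy_term)
  have S: "?Vx * ?Vz * S =
      fdet n (\<lambda>i j. graded_sum (\<lambda>l. ?x i ^ l * ((1 - t ^ Suc l) * poly (chebU l) (?z j))))"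
    unfolding S_def g_def using hom_x hom_z hom_t Vx_nz Vz_nz gx gz by (rule cauchy_identity_mps)

  have term_eq: "(\<Prod>i=1..n. 1 - tvar ^ (part lam i + n + 1 - i)) * schur n lam xvar * symplectic n lam yvar =
      to_fract (g lam)" for lam
  proof -
    have "(\<Prod>i=1..n. 1 - tvar ^ (part lam i + n + 1 - i)) =
        to_fract (\<Prod>i<n. 1 - t ^ Suc (exponents n lam i))"
      unfolding prod_from_1 to_fract_prod vars
      by (rule prod.cong) (auto simp: exponents_def to_fract_power Suc_diff_Suc simp del: power_Suc
          intro!: arg_cong[of _ _ "\<lambda>k. to_fract t ^ k"])
    moreover have "schur n lam xvar = to_fract (gx lam)"
      unfolding vars by (rule schur_to_fract[OF gx Vx_nz])
    moreover have "symplectic n lam yvar = to_fract (gz lam)"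
      unfolding vars
      by (rule symplectic_to_fract[OF inv y_nz gz[unfolded z_def] Vz_nz[unfolded z_def]])
    ultimately show ?thesis
      unfolding g to_fract_mult by simp
  qed

  define A where "A i j = graded_sum (\<lambda>l. ?x i ^ l * ((1 - t ^ Suc l) * poly (chebU l) (?z j)))" for i j
  define Q where "Q i j = (1 - ?x i * ?z j + ?x i ^ 2) * (1 - t * ?x i * ?z j + (t * ?x i) ^ 2)" for i j
  have QA: "Q i j * A i j = (1 - t) * (1 - t * ?x i ^ 2)" for i j
    unfolding Q_def A_def by (rule chebU_generating_function[OF hom_x hom_z hom_t])
  have Q_nz: "Q i j \<noteq> 0" for i j
  proof -
    \<comment> \<open>Apart from the 1 in each factor, every term contains the variable
      \<open>?x i\<close>.\<close>
    have "mps_coeff (Q i j) {#} = 1"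
      by (simp add: Q_def mps_coeff_mult_empty power2_eq_square x_def)
    then show ?thesis by auto
  qed
  have Q_factor: "(1 - ?x i * y (Suc j)) * (1 - t * ?x i * y (Suc j)) * (1 - ?x i * y' (Suc j)) *
      (1 - t * ?x i * y' (Suc j)) = Q i j" for i j
  proof -
    \<comment> \<open>Pairing the factors in \<open>y\<close> and \<open>y'\<close> for
      \<open>u = ?x i\<close> and \<open>u = t * ?x i\<close> produces the two quadratics of
      \<open>Q\<close>.\<close>
    have key: "(1 - u * y (Suc j)) * (1 - u * y' (Suc j)) = 1 - u * ?z j + u ^ 2" for u
    proof -
      have "(1 - u * y (Suc j)) * (1 - u * y' (Suc j)) = 1 - u * ?z j + u ^ 2 * (y (Suc j) * y' (Suc j))"
        by (simp add: z_def algebra_simps power2_eq_square)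
      then show ?thesis by (simp add: inv)
    qed
    have "(1 - ?x i * y (Suc j)) * (1 - t * ?x i * y (Suc j)) * (1 - ?x i * y' (Suc j)) *
        (1 - t * ?x i * y' (Suc j)) =
        ((1 - ?x i * y (Suc j)) * (1 - ?x i * y' (Suc j))) *
        ((1 - t * ?x i * y (Suc j)) * (1 - t * ?x i * y' (Suc j)))"
      by (simp only: mult.assoc mult.commute mult.left_commute)
    then show ?thesis
      unfolding key Q_def .
  qed
  have entry: "to_fract (1 - t * ?x i ^ 2) * (to_fract (1 - t) / to_fract (Q i j)) = to_fract (A i j)" for i j
  proof -
    have "(1 - t * ?x i ^ 2) * (1 - t) = A i j * Q i j"
      using QA[of i j] by (simp only: mult.commute)
    then have "to_fract (1 - t * ?x i ^ 2) * to_fract (1 - t) = to_fract (A i j) * to_fract (Q i j)"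
      unfolding to_fract_mult[symmetric] by (rule arg_cong)
    then show ?thesis
      unfolding times_divide_eq_right by (simp only:) (simp add: Q_nz)
  qed
  \<comment> \<open>The prefactors enter the determinant as row factors, which turns every entry
    into the series \<open>A i j\<close>.\<close>
  have "(\<Prod>i=1..n. 1 - tvar * xvar i ^ 2) * det_from1 n (\<lambda>i j. (1 - tvar) /
       ((1 - xvar i * yvar j) * (1 - tvar * xvar i * yvar j) *
        (1 - xvar i * (1 / yvar j)) * (1 - tvar * xvar i * (1 / yvar j)))) = 
      (\<Prod>i<n. to_fract (1 - t * ?x i ^ 2)) * fdet n (\<lambda>i j. to_fract (1 - t) / to_fract (Q i j))"
    unfolding prod_from_1 det_from1_eq_fdet vars yi Q_factor[symmetric]
    by (simp add: to_fract_power)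
  also have "\<dots> = to_fract (fdet n A)"
    unfolding fdet_scale_rows[symmetric] entry to_fract_fdet ..
  also have "fdet n A = ?Vx * ?Vz * S"
    unfolding S A_def ..
  finally have num: "(\<Prod>i=1..n. 1 - tvar * xvar i ^ 2) * det_from1 n (\<lambda>i j. (1 - tvar) /
       ((1 - xvar i * yvar j) * (1 - tvar * xvar i * yvar j) *
        (1 - xvar i * (1 / yvar j)) * (1 - tvar * xvar i * (1 / yvar j)))) = to_fract (?Vx * ?Vz) * to_fract S"
    by simp
  have den: "(\<Prod>j=1..n. \<Prod>i=1..<j. xvar i - xvar j) * (\<Prod>j=1..n. \<Prod>i=1..<j. yvar i - yvar j) *
      (\<Prod>j=1..n. \<Prod>i=1..<j. 1 - (1 / yvar i) * (1 / yvar j)) = to_fract (?Vx * ?Vz)"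
    unfolding vars yi prod_triangle_from_1 z_def inverse_pair_diff[OF inv inv, symmetric]
    by (simp only: to_fract_mult to_fract_prod to_fract_diff to_fract_1 prod.distrib mult.assoc)
  have "to_fract (?Vx * ?Vz) \<noteq> 0"
    unfolding to_fract_eq_0_iff mult_eq_0_iff using Vx_nz Vz_nz by blast
  then have rhs: "to_fract S = (\<Prod>i=1..n. 1 - tvar * xvar i ^ 2) /
     ((\<Prod>j=1..n. \<Prod>i=1..<j. xvar i - xvar j) *
      (\<Prod>j=1..n. \<Prod>i=1..<j. yvar i - yvar j) *
      (\<Prod>j=1..n. \<Prod>i=1..<j. 1 - (1 / yvar i) * (1 / yvar j))) *
     det_from1 n (\<lambda>i j. (1 - tvar) /
       ((1 - xvar i * yvar j) * (1 - tvar * xvar i * yvar j) *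
        (1 - xvar i * (1 / yvar j)) * (1 - tvar * xvar i * (1 / yvar j))))"
    unfolding den unfolding times_divide_eq_left num by (rule nonzero_mult_div_cancel_left[symmetric])
  show ?thesis
    unfolding rhs[symmetric] partitions_upto_def[symmetric] S_def
    by (rule has_formal_sum_family_sum) (use g_hom finite_partitions_weight term_eq in auto)
qed

end
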